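(* Let $T$ be a closed $\lambda C$-term such that $\vdash_{M2} T : \forall x\{N^C[x] \rightarrow \neg\neg N[x]\}$. Then $T$ is a storage operator for classical integers: for every integer $n\geq 0$ there is a $\lambda C$-term $\tau_n$ with $\tau_n \simeq_\beta \underline{n}$ such that for every classical integer $\theta_n$ of value $n$ there is a substitution $\sigma$ with $(T)\theta_n f \succ_C (f)\sigma(\tau_n)$, where $f$ is a variable.
   Context: $\lambda C$-terms are the terms of the pure $\lambda$-calculus extended with one constant $C$; application is written $(t)u$ and $(t)u_1\dots u_n$ abbreviates $(\dots((t)u_1)\dots)u_n$. Head $C$-reduction $\succ_C$ is the reflexive–transitive closure of the two rules $(\lambda x u)t\,t_1\dots t_n \to (u[t/x])t_1\dots t_n$ and $(C)t\,t_1\dots t_n \to (t)\lambda x(x)t_1\dots t_n$ ($x$ not free in $t_1,\dots,t_n$). $\simeq_\beta$ is $\beta$-equivalence ($C$ treated as an inert constant). The Church integer is $\underline{n}=\lambda x\lambda f(f)^n x$, where $(f)^n x$ is $(f)\dots(f)x$ with $n$ occurrences of $f$. A substitution $\sigma$ replaces free variables by terms. Types are formulas of second-order predicate logic built from atomic formulas ($\perp$, and $R(t_1,\dots,t_k)$ with $R$ a $k$-ary predicate symbol or predicate variable and $t_i$ first-order terms of a language containing a constant $0$ and a unary function symbol $s$) using $\rightarrow$, $\forall x$ (first-order) and $\forall X$ (second-order). $\neg A$ is $A\rightarrow\perp$ and $A_1,\dots,A_n\rightarrow B$ is $A_1\rightarrow(\dots\rightarrow(A_n\rightarrow B))$. An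 equation $u=v$ is the formula $\forall Y(Y(u)\rightarrow Y(v))$; a fixed set $E$ of equations is given and $a\approx b$ means $a=b$ is a consequence of $E$; $E$ is assumed adequate for integers: $s(a)\not\approx 0$, and $s(a)\approx s(b)$ implies $a\approx b$. System $AF2$ derives judgments $\Gamma\vdash t:A$ ($\Gamma$ a context $x_1:A_1,\dots,x_n:A_n$) by: (1) $\Gamma\vdash x_i:A_i$; (2) from $\Gamma,x:A\vdash t:B$ infer $\Gamma\vdash\lambda x t:A\rightarrow B$; (3) from $\Gamma\vdash u:A\rightarrow B$ and $\Gamma\vdash v:A$ infer $\Gamma\vdash(u)v:B$; (4) from $\Gamma\vdash t:A$, $x$ not free in $\Gamma$, infer $\Gamma\vdash t:\forall xA$; (5) from $\Gamma\vdash t:\forall xA$ infer $\Gamma\vdash t:A[u/x]$ for any term $u$; (6) from $\Gamma\vdash t:A$, $X$ not free in $\Gamma$, infer $\Gamma\vdash t:\forall XA$; (7) from $\Gamma\vdash t:\forall XA$ infer $\Gamma\vdash t:A[G/X]$ for any formula $G$; (8) from $\Gamma\vdash t:A[u/x]$ and $u\approx v$ infer $\Gamma\vdash t:A[v/x]$. System $M2$: for each arity there is in addition a countable set of special predicate variables $X_C,Y_C,\dots$ called classical variables. A type ends with $X$ ($X$ a predicate variable/symbol or $\perp$) if it is $X(t_1,\dots,t_n)$, or $A\rightarrow B$ with $B$ ending with $X$, or $\forall vA$ with $A$ ending with $X$. A classical type is a type ending with $\perp$ or with a classical variable. $M2$ consists of the rules of $AF2$ (rules (6),(7) for ordinary predicate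 variables) together with: (0') $\Gamma\vdash C:\forall X_C\{\neg\neg X_C\rightarrow X_C\}$; (6') from $\Gamma\vdash t:A$, $X_C$ not free in $\Gamma$, infer $\Gamma\vdash t:\forall X_C A$; (7') from $\Gamma\vdash t:\forall X_CA$ infer $\Gamma\vdash t:A[G/X_C]$ for every classical type $G$. $N[x]=\forall X\{X(0),\forall y(X(y)\rightarrow X(sy))\rightarrow X(x)\}$ and $N^C[x]=\forall X_C\{X_C(0),\forall y(X_C(y)\rightarrow X_C(sy))\rightarrow X_C(x)\}$ ($X$, $X_C$ unary). A classical integer of value $n$ is a closed $\lambda C$-term $\theta_n$ with $\vdash_{M2}\theta_n:N^C[s^n(0)]$. *)

theory Defs
  imports Main
begin

text \<open>
  All binding is represented by de Bruijn indices, and substitutions are parallel ones.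
  On \<open>\<lambda>C\<close>-terms a free variable is an index that points beyond all enclosing binders.
\<close>

section \<open>\<open>\<lambda>C\<close>-terms\<close>

datatype trm = Var nat | CC | Lam trm | App trm trm

abbreviation Apps :: "trm \<Rightarrow> trm list \<Rightarrow> trm" where
  "Apps t us \<equiv> foldl App t us"

primrec free_vars :: "trm \<Rightarrow> nat set" where
  "free_vars (Var i) = {i}"
| "free_vars CC = {}"
| "free_vars (Lam t) = {i. Suc i \<in> free_vars t}"
| "free_vars (App t u) = free_vars t \<union> free_vars u"

definition closed_trm :: "trm \<Rightarrow> bool" where
  "closed_trm t \<longleftrightarrow> free_vars t = {}"

primrec rename :: "(nat \<Rightarrow> nat) \<Rightarrow> trm \<Rightarrow> trm" where
  "rename r (Var i) = Var (r i)"
| "rename r CC = CC"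
| "rename r (Lam t) = Lam (rename (case_nat 0 (\<lambda>i. Suc (r i))) t)"
| "rename r (App t u) = App (rename r t) (rename r u)"

primrec subst :: "(nat \<Rightarrow> trm) \<Rightarrow> trm \<Rightarrow> trm" where
  "subst \<sigma> (Var i) = \<sigma> i"
| "subst \<sigma> CC = CC"
| "subst \<sigma> (Lam t) = Lam (subst (case_nat (Var 0) (\<lambda>i. rename Suc (\<sigma> i))) t)"
| "subst \<sigma> (App t u) = App (subst \<sigma> t) (subst \<sigma> u)"

text \<open>\<open>subst0 t u\<close> is \<open>u[t/x]\<close>, where \<open>x\<close> is the variable bound in \<open>Lam u\<close>.\<close>

definition subst0 :: "trm \<Rightarrow> trm \<Rightarrow> trm" where
  "subst0 t u = subst (case_nat t Var) u"

inductive beta :: "trm \<Rightarrow> trm \<Rightarrow> bool" where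
  beta_red: "beta (App (Lam u) t) (subst0 t u)"
| beta_Lam: "beta t t' \<Longrightarrow> beta (Lam t) (Lam t')"
| beta_AppL: "beta t t' \<Longrightarrow> beta (App t u) (App t' u)"
| beta_AppR: "beta u u' \<Longrightarrow> beta (App t u) (App t u')"

abbreviation beta_equiv :: "trm \<Rightarrow> trm \<Rightarrow> bool" where
  "beta_equiv \<equiv> equivclp beta"

inductive headC_step :: "trm \<Rightarrow> trm \<Rightarrow> bool" where
  head_beta: "headC_step (Apps (App (Lam u) t) ts) (Apps (subst0 t u) ts)"
| head_C: "headC_step (Apps (App CC t) ts) (App t (Lam (Apps (Var 0) (map (rename Suc) ts))))"

abbreviation headC_red :: "trm \<Rightarrow> trm \<Rightarrow> bool" where
  "headC_red \<equiv> headC_step\<^sup>*\<^sup>*"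

text \<open>The integer \<open>n\<close> is \<open>\<lambda>x \<lambda>f. (f)\<^sup>n x\<close>: the numeral binds \<open>x\<close> first.\<close>

definition church :: "nat \<Rightarrow> trm" where
  "church n = Lam (Lam ((App (Var 0) ^^ n) (Var 1)))"


section \<open>Second-order formulas\<close>

text \<open>The symbols of a language are those whose arity is defined.\<close>

record ('f, 'p) language =
  fun_arity :: "'f \<Rightarrow> nat option"
  pred_arity :: "'p \<Rightarrow> nat option"
  zero_sym :: 'f
  suc_sym :: 'f

definition is_language :: "('f, 'p) language \<Rightarrow> bool" where
  "is_language L \<longleftrightarrow> fun_arity L (zero_sym L) = Some 0 \<and> fun_arity L (suc_sym L) = Some 1"

datatype 'f fotm = TVar nat | Fn 'f "'f fotm list"

fun wf_tm :: "('f, 'p) language \<Rightarrow> 'f fotm \<Rightarrow> bool" where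
  "wf_tm L (TVar i) \<longleftrightarrow> True"
| "wf_tm L (Fn f ts) \<longleftrightarrow> fun_arity L f = Some (length ts) \<and> (\<forall>t\<in>set ts. wf_tm L t)"

primrec tsubst :: "(nat \<Rightarrow> 'f fotm) \<Rightarrow> 'f fotm \<Rightarrow> 'f fotm" where
  "tsubst \<sigma> (TVar i) = \<sigma> i"
| "tsubst \<sigma> (Fn f ts) = Fn f (map (tsubst \<sigma>) ts)"

definition zero_tm :: "('f, 'p) language \<Rightarrow> 'f fotm" where
  "zero_tm L = Fn (zero_sym L) []"

definition suc_tm :: "('f, 'p) language \<Rightarrow> 'f fotm \<Rightarrow> 'f fotm" where
  "suc_tm L a = Fn (suc_sym L) [a]"

datatype kind = Ordinary | Classical

text \<open>
  A predicate variable is given by its kind, its arity and an index within that kind and arity; the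
  arity of an occurrence \<open>PVar \<kappa> i ts\<close> is \<open>length ts\<close>. So \<open>PVar \<kappa> i ts\<close> refers to the \<open>i\<close>-th
  enclosing binder \<open>All2 \<kappa> (length ts)\<close>, not counting second-order binders of another kind or arity.
  First-order indices refer to the binders \<open>All1\<close>.
\<close>

datatype ('f, 'p) fm =
    Bot
  | Rel 'p "'f fotm list"
  | PVar kind nat "'f fotm list"
  | Imp "('f, 'p) fm" "('f, 'p) fm"
  | All1 "('f, 'p) fm"
  | All2 kind nat "('f, 'p) fm"

abbreviation Neg :: "('f, 'p) fm \<Rightarrow> ('f, 'p) fm" where
  "Neg A \<equiv> Imp A Bot"

primrec wf_fm :: "('f, 'p) language \<Rightarrow> ('f, 'p) fm \<Rightarrow> bool" where
  "wf_fm L Bot \<longleftrightarrow> True"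
| "wf_fm L (Rel P ts) \<longleftrightarrow> pred_arity L P = Some (length ts) \<and> (\<forall>t\<in>set ts. wf_tm L t)"
| "wf_fm L (PVar \<kappa> i ts) \<longleftrightarrow> (\<forall>t\<in>set ts. wf_tm L t)"
| "wf_fm L (Imp A B) \<longleftrightarrow> wf_fm L A \<and> wf_fm L B"
| "wf_fm L (All1 A) \<longleftrightarrow> wf_fm L A"
| "wf_fm L (All2 \<kappa> k A) \<longleftrightarrow> wf_fm L A"

primrec fsubst :: "(nat \<Rightarrow> 'f fotm) \<Rightarrow> ('f, 'p) fm \<Rightarrow> ('f, 'p) fm" where
  "fsubst \<sigma> Bot = Bot"
| "fsubst \<sigma> (Rel P ts) = Rel P (map (tsubst \<sigma>) ts)"
| "fsubst \<sigma> (PVar \<kappa> i ts) = PVar \<kappa> i (map (tsubst \<sigma>) ts)"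
| "fsubst \<sigma> (Imp A B) = Imp (fsubst \<sigma> A) (fsubst \<sigma> B)"
| "fsubst \<sigma> (All1 A) =
     All1 (fsubst (case_nat (TVar 0) (\<lambda>i. tsubst (\<lambda>j. TVar (Suc j)) (\<sigma> i))) A)"
| "fsubst \<sigma> (All2 \<kappa> k A) = All2 \<kappa> k (fsubst \<sigma> A)"

definition flift :: "('f, 'p) fm \<Rightarrow> ('f, 'p) fm" where
  "flift A = fsubst (\<lambda>i. TVar (Suc i)) A"

text \<open>\<open>finst u A\<close> is \<open>A[u/x]\<close>, where \<open>x\<close> is the variable bound in \<open>All1 A\<close>.\<close>

definition finst :: "'f fotm \<Rightarrow> ('f, 'p) fm \<Rightarrow> ('f, 'p) fm" where
  "finst u A = fsubst (case_nat u TVar) A"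

text \<open>Renamings and substitutions of predicate variables take kind, arity and index.\<close>

primrec prename :: "(kind \<Rightarrow> nat \<Rightarrow> nat \<Rightarrow> nat) \<Rightarrow> ('f, 'p) fm \<Rightarrow> ('f, 'p) fm" where
  "prename r Bot = Bot"
| "prename r (Rel P ts) = Rel P ts"
| "prename r (PVar \<kappa> i ts) = PVar \<kappa> (r \<kappa> (length ts) i) ts"
| "prename r (Imp A B) = Imp (prename r A) (prename r B)"
| "prename r (All1 A) = All1 (prename r A)"
| "prename r (All2 \<kappa> k A) = All2 \<kappa> k (prename
     (\<lambda>\<kappa>' k'. if \<kappa>' = \<kappa> \<and> k' = k then case_nat 0 (\<lambda>i. Suc (r \<kappa> k i)) else r \<kappa>' k') A)"

definition plift :: "kind \<Rightarrow> nat \<Rightarrow> ('f, 'p) fm \<Rightarrow> ('f, 'p) fm" where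
  "plift \<kappa> k A = prename (\<lambda>\<kappa>' k' i. if \<kappa>' = \<kappa> \<and> k' = k then Suc i else i) A"

text \<open>
  A formula \<open>G\<close> that is to replace a predicate variable of arity \<open>k\<close> is a formula with
  distinguished first-order variables \<open>x\<^sub>1, \<dots>, x\<^sub>k\<close>: these are its indices \<open>0, \<dots>, k - 1\<close>, and an index
  \<open>j \<ge> k\<close> stands for the variable \<open>j - k\<close> of the surrounding context.
  \<open>abs_inst ts G\<close> is \<open>G[t\<^sub>1/x\<^sub>1, \<dots>, t\<^sub>k/x\<^sub>k]\<close>.
\<close>

definition abs_inst :: "'f fotm list \<Rightarrow> ('f, 'p) fm \<Rightarrow> ('f, 'p) fm" where
  "abs_inst ts G = fsubst (\<lambda>j. if j < length ts then ts ! j else TVar (j - length ts)) G"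

definition abs_flift :: "nat \<Rightarrow> ('f, 'p) fm \<Rightarrow> ('f, 'p) fm" where
  "abs_flift k G = fsubst (\<lambda>j. TVar (if j < k then j else Suc j)) G"

definition abs_pvar :: "kind \<Rightarrow> nat \<Rightarrow> nat \<Rightarrow> ('f, 'p) fm" where
  "abs_pvar \<kappa> k i = PVar \<kappa> i (map TVar [0..<k])"

primrec psubst :: "(kind \<Rightarrow> nat \<Rightarrow> nat \<Rightarrow> ('f, 'p) fm) \<Rightarrow> ('f, 'p) fm \<Rightarrow> ('f, 'p) fm" where
  "psubst S Bot = Bot"
| "psubst S (Rel P ts) = Rel P ts"
| "psubst S (PVar \<kappa> i ts) = abs_inst ts (S \<kappa> (length ts) i)"
| "psubst S (Imp A B) = Imp (psubst S A) (psubst S B)"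
| "psubst S (All1 A) = All1 (psubst (\<lambda>\<kappa> k i. abs_flift k (S \<kappa> k i)) A)"
| "psubst S (All2 \<kappa> k A) = All2 \<kappa> k (psubst
     (\<lambda>\<kappa>' k'. if \<kappa>' = \<kappa> \<and> k' = k
        then case_nat (abs_pvar \<kappa> k 0) (\<lambda>i. plift \<kappa> k (S \<kappa> k i))
        else (\<lambda>i. plift \<kappa> k (S \<kappa>' k' i))) A)"

text \<open>\<open>pinst \<kappa> k G A\<close> is \<open>A[G/X]\<close>, where \<open>X\<close> is the variable bound in \<open>All2 \<kappa> k A\<close>.\<close>

definition pinst :: "kind \<Rightarrow> nat \<Rightarrow> ('f, 'p) fm \<Rightarrow> ('f, 'p) fm \<Rightarrow> ('f, 'p) fm" where
  "pinst \<kappa> k G A = psubst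
     (\<lambda>\<kappa>' k'. if \<kappa>' = \<kappa> \<and> k' = k then case_nat G (abs_pvar \<kappa> k) else abs_pvar \<kappa>' k') A"

text \<open>A type is classical if it ends with \<open>\<bottom>\<close> or with a classical variable.\<close>

primrec classical_type :: "('f, 'p) fm \<Rightarrow> bool" where
  "classical_type Bot \<longleftrightarrow> True"
| "classical_type (Rel P ts) \<longleftrightarrow> False"
| "classical_type (PVar \<kappa> i ts) \<longleftrightarrow> \<kappa> = Classical"
| "classical_type (Imp A B) \<longleftrightarrow> classical_type B"
| "classical_type (All1 A) \<longleftrightarrow> classical_type A"
| "classical_type (All2 \<kappa> k A) \<longleftrightarrow> classical_type A"


section \<open>Consequences of a set of equations\<close>

definition Eqn :: "'f fotm \<Rightarrow> 'f fotm \<Rightarrow> ('f, 'p) fm" where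
  "Eqn u v = All2 Ordinary 1 (Imp (PVar Ordinary 0 [u]) (PVar Ordinary 0 [v]))"

text \<open>
  Deducibility in second-order predicate logic from a set of equations, whose free first-order
  variables are understood as universally quantified. The logical rules are those of \<open>AF2\<close>
  without the terms. No rule concerns the quantifier over classical variables, which
  are a device of the type system only.
\<close>

inductive deducible ::
  "('f, 'p) language \<Rightarrow> ('f fotm \<times> 'f fotm) set \<Rightarrow> ('f, 'p) fm list \<Rightarrow> ('f, 'p) fm \<Rightarrow> bool"
  for L :: "('f, 'p) language" and E :: "('f fotm \<times> 'f fotm) set" where
  d_equation: "(u, v) \<in> E \<Longrightarrow> \<forall>i. wf_tm L (\<sigma> i) \<Longrightarrow> \<forall>B\<in>set \<Gamma>. wf_fm L B \<Longrightarrow>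
    deducible L E \<Gamma> (Eqn (tsubst \<sigma> u) (tsubst \<sigma> v))"
| d_hyp: "A \<in> set \<Gamma> \<Longrightarrow> \<forall>B\<in>set \<Gamma>. wf_fm L B \<Longrightarrow> deducible L E \<Gamma> A"
| d_ImpI: "deducible L E (A # \<Gamma>) B \<Longrightarrow> deducible L E \<Gamma> (Imp A B)"
| d_ImpE: "deducible L E \<Gamma> (Imp A B) \<Longrightarrow> deducible L E \<Gamma> A \<Longrightarrow> deducible L E \<Gamma> B"
| d_All1I: "deducible L E (map flift \<Gamma>) A \<Longrightarrow> deducible L E \<Gamma> (All1 A)"
| d_All1E: "deducible L E \<Gamma> (All1 A) \<Longrightarrow> wf_tm L u \<Longrightarrow> deducible L E \<Gamma> (finst u A)"
| d_All2I: "deducible L E (map (plift Ordinary k) \<Gamma>) A \<Longrightarrow>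
    deducible L E \<Gamma> (All2 Ordinary k A)"
| d_All2E: "deducible L E \<Gamma> (All2 Ordinary k A) \<Longrightarrow> wf_fm L G \<Longrightarrow>
    deducible L E \<Gamma> (pinst Ordinary k G A)"

text \<open>The relation \<open>a \<approx> b\<close>:\<close>

definition eq_conseq ::
  "('f, 'p) language \<Rightarrow> ('f fotm \<times> 'f fotm) set \<Rightarrow> 'f fotm \<Rightarrow> 'f fotm \<Rightarrow> bool" where
  "eq_conseq L E a b \<longleftrightarrow> wf_tm L a \<and> wf_tm L b \<and> deducible L E [] (Eqn a b)"

definition wf_equations :: "('f, 'p) language \<Rightarrow> ('f fotm \<times> 'f fotm) set \<Rightarrow> bool" where
  "wf_equations L E \<longleftrightarrow> (\<forall>(u, v)\<in>E. wf_tm L u \<and> wf_tm L v)"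

definition adequate_for_integers ::
  "('f, 'p) language \<Rightarrow> ('f fotm \<times> 'f fotm) set \<Rightarrow> bool" where
  "adequate_for_integers L E \<longleftrightarrow>
     (\<forall>a. \<not> eq_conseq L E (suc_tm L a) (zero_tm L)) \<and>
     (\<forall>a b. eq_conseq L E (suc_tm L a) (suc_tm L b) \<longrightarrow> eq_conseq L E a b)"


section \<open>The system \<open>M2\<close>\<close>

text \<open>
  The context \<open>\<Gamma>\<close> lists the types of the \<open>\<lambda>C\<close>-variables: \<open>\<Gamma> ! i\<close> is the type of \<open>Var i\<close>. A variable
  that does not occur free in \<open>\<Gamma>\<close> is obtained by lifting \<open>\<Gamma>\<close>.
\<close>

inductive M2 ::
  "('f, 'p) language \<Rightarrow> ('f fotm \<times> 'f fotm) set \<Rightarrow> ('f, 'p) fm list \<Rightarrow> trm \<Rightarrow> ('f, 'p) fm \<Rightarrow> bool"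
  for L :: "('f, 'p) language" and E :: "('f fotm \<times> 'f fotm) set" where
  M2_C: "\<forall>B\<in>set \<Gamma>. wf_fm L B \<Longrightarrow>
    M2 L E \<Gamma> CC (All2 Classical 0 (Imp (Neg (Neg (PVar Classical 0 []))) (PVar Classical 0 [])))"
| M2_Var: "i < length \<Gamma> \<Longrightarrow> \<forall>B\<in>set \<Gamma>. wf_fm L B \<Longrightarrow> M2 L E \<Gamma> (Var i) (\<Gamma> ! i)"
| M2_Lam: "M2 L E (A # \<Gamma>) t B \<Longrightarrow> M2 L E \<Gamma> (Lam t) (Imp A B)"
| M2_App: "M2 L E \<Gamma> u (Imp A B) \<Longrightarrow> M2 L E \<Gamma> v A \<Longrightarrow> M2 L E \<Gamma> (App u v) B"
| M2_All1I: "M2 L E (map flift \<Gamma>) t A \<Longrightarrow> M2 L E \<Gamma> t (All1 A)"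
| M2_All1E: "M2 L E \<Gamma> t (All1 A) \<Longrightarrow> wf_tm L u \<Longrightarrow> M2 L E \<Gamma> t (finst u A)"
| M2_All2I: "M2 L E (map (plift \<kappa> k) \<Gamma>) t A \<Longrightarrow> M2 L E \<Gamma> t (All2 \<kappa> k A)"
| M2_All2E: "M2 L E \<Gamma> t (All2 Ordinary k A) \<Longrightarrow> wf_fm L G \<Longrightarrow>
    M2 L E \<Gamma> t (pinst Ordinary k G A)"
| M2_All2E_classical: "M2 L E \<Gamma> t (All2 Classical k A) \<Longrightarrow> wf_fm L G \<Longrightarrow> classical_type G \<Longrightarrow>
    M2 L E \<Gamma> t (pinst Classical k G A)"
| M2_eq: "M2 L E \<Gamma> t (finst u A) \<Longrightarrow> eq_conseq L E u v \<Longrightarrow> M2 L E \<Gamma> t (finst v A)"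


section \<open>Integers\<close>

text \<open>\<open>Nat_fm L Ordinary a\<close> is \<open>N[a]\<close> and \<open>Nat_fm L Classical a\<close> is \<open>N\<^sup>C[a]\<close>.\<close>

definition Nat_fm :: "('f, 'p) language \<Rightarrow> kind \<Rightarrow> 'f fotm \<Rightarrow> ('f, 'p) fm" where
  "Nat_fm L \<kappa> a = All2 \<kappa> 1
     (Imp (PVar \<kappa> 0 [zero_tm L])
     (Imp (All1 (Imp (PVar \<kappa> 0 [TVar 0]) (PVar \<kappa> 0 [suc_tm L (TVar 0)])))
          (PVar \<kappa> 0 [a])))"

definition classical_integer ::
  "('f, 'p) language \<Rightarrow> ('f fotm \<times> 'f fotm) set \<Rightarrow> nat \<Rightarrow> trm \<Rightarrow> bool" where
  "classical_integer L E n \<theta> \<longleftrightarrow>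
     closed_trm \<theta> \<and> M2 L E [] \<theta> (Nat_fm L Classical ((suc_tm L ^^ n) (zero_tm L)))"

end

theory Submission
  imports Defs "HOL-Library.Countable"
begin

text \<open>
  Run \<open>T\<close> on a symbol \<open>\<nu>\<close> instead of an integer. When \<open>\<nu>\<close> reaches the head with arguments \<open>a\<close>, \<open>b\<close> and a
  stack \<open>\<pi>\<close>, continue with \<open>(b) x \<pi>\<close>, where \<open>x\<close> is a new symbol of level \<open>n - 1\<close>; a symbol of level
  \<open>k + 1\<close> is treated in the same way, and a symbol of level \<open>0\<close> is replaced by \<open>a\<close>. Realizability with
  the set of terms whose symbolic run reaches some \<open>(f) \<tau>\<close> with \<open>\<tau> \<simeq>\<^sub>\<beta> n\<close> as pole shows that the run
  of \<open>T\<close> does so. Here classical types denote orthogonals of sets of stacks, but ordinary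
  predicate variables range over all sets closed under head \<open>\<beta>\<close>-expansion, so that a realizer of
  \<open>N[s\<^sup>n(0)]\<close> has to be \<open>\<beta>\<close>-equivalent to the integer.

  A classical integer \<open>\<theta>\<close> may backtrack, but a restarted computation repeats the symbolic run with
  other values of the symbols. So, by induction along the symbolic run, all its instances reach some
  \<open>(f) \<sigma>(\<tau>)\<close>: at a call of \<open>\<nu>\<close> one uses that \<open>\<theta>\<close> realizes \<open>N\<^sup>C[s\<^sup>n(0)]\<close> for the pole of the
  terms that reach this form, where the truth value at level \<open>k\<close> is given by the stacks on which
  \<open>k\<close> further calls of \<open>b\<close> and one call of \<open>a\<close> succeed.
\<close>

section \<open>Substitution in \<open>\<lambda>C\<close>-terms\<close>

text \<open>
  With this congruence rule the simplifier would not rewrite the branches of the \<open>case_nat\<close> terms by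
  which substitutions are extended under a binder.
\<close>

declare nat.case_cong_weak [cong del]

lemma case_nat_comp: "(\<lambda>i. h (case_nat a g i)) = case_nat (h a) (\<lambda>i. h (g i))"
  by (auto split: nat.split)

lemma rename_rename: "rename r (rename s t) = rename (\<lambda>i. r (s i)) t"
  by (induction t arbitrary: r s) (simp_all add: case_nat_comp)

lemma subst_rename: "subst \<sigma> (rename r t) = subst (\<lambda>i. \<sigma> (r i)) t"
  by (induction t arbitrary: \<sigma> r) (simp_all add: case_nat_comp)

lemma rename_subst: "rename r (subst \<sigma> t) = subst (\<lambda>i. rename r (\<sigma> i)) t"
  by (induction t arbitrary: \<sigma> r) (simp_all add: case_nat_comp rename_rename)

lemma subst_subst: "subst \<sigma> (subst \<rho> t) = subst (\<lambda>i. subst \<sigma> (\<rho> i)) t"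
  by (induction t arbitrary: \<sigma> \<rho>) (simp_all add: case_nat_comp subst_rename rename_subst)

lemma subst_cong: "(\<And>i. i \<in> free_vars t \<Longrightarrow> \<sigma> i = \<rho> i) \<Longrightarrow> subst \<sigma> t = subst \<rho> t"
proof (induction t arbitrary: \<sigma> \<rho>)
  case (Lam t)
  have "case_nat (Var 0) (\<lambda>i. rename Suc (\<sigma> i)) i = case_nat (Var 0) (\<lambda>i. rename Suc (\<rho> i)) i"
    if "i \<in> free_vars t" for i
    using Lam.prems that by (cases i) auto
  then show ?case
    unfolding subst.simps trm.inject by (rule Lam.IH)
next
  case (App t u)
  have "subst \<sigma> t = subst \<rho> t" "subst \<sigma> u = subst \<rho> u"
    using App.prems by (auto intro!: App.IH)
  then show ?case
    by simp
qed auto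

lemma subst_Var: "subst Var t = t"
proof -
  have up: "case_nat (Var 0) (\<lambda>i. Var (Suc i)) = Var"
    by (auto split: nat.split)
  show ?thesis
    by (induction t) (simp_all add: up)
qed

lemma rename_eq_subst: "rename r t = subst (\<lambda>i. Var (r i)) t"
  using rename_subst[of r Var t] by (simp add: subst_Var)

lemma subst_closed: "closed_trm t \<Longrightarrow> subst \<sigma> t = t"
  using subst_cong[of t \<sigma> Var] by (simp add: closed_trm_def subst_Var)

lemma subst_Apps: "subst \<sigma> (Apps t ts) = Apps (subst \<sigma> t) (map (subst \<sigma>) ts)"
  by (induction ts arbitrary: t) auto

lemma subst0_subst_up:
  "subst0 v (subst (case_nat (Var 0) (\<lambda>i. rename Suc (\<rho> i))) t) = subst (case_nat v \<rho>) t"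
  by (simp add: subst0_def subst_subst case_nat_comp subst_rename subst_Var)

lemma subst_subst0:
  "subst \<sigma> (subst0 t u) = subst0 (subst \<sigma> t) (subst (case_nat (Var 0) (\<lambda>i. rename Suc (\<sigma> i))) u)"
  by (simp add: subst0_subst_up) (simp add: subst0_def subst_subst case_nat_comp)

lemma headC_step_subst: "headC_step t t' \<Longrightarrow> headC_step (subst \<sigma> t) (subst \<sigma> t')"
proof (induction rule: headC_step.induct)
  case (head_beta u t ts)
  then show ?case
    by (simp add: subst_Apps subst_subst0 headC_step.head_beta)
next
  case (head_C t ts)
  have "headC_step (Apps (App CC (subst \<sigma> t)) (map (subst \<sigma>) ts))
      (App (subst \<sigma> t) (Lam (Apps (Var 0) (map (rename Suc) (map (subst \<sigma>) ts)))))"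
    by (rule headC_step.head_C)
  then show ?case
    by (simp add: subst_Apps subst_rename rename_subst o_def)
qed

section \<open>Free variables and head reduction\<close>

lemma free_vars_rename: "free_vars (rename r t) = r ` free_vars t"
proof (induction t arbitrary: r)
  case (Lam t)
  show ?case
  proof (intro set_eqI iffI)
    fix i assume "i \<in> free_vars (rename r (Lam t))"
    then obtain j where "j \<in> free_vars t" "Suc i = (case j of 0 \<Rightarrow> 0 | Suc k \<Rightarrow> Suc (r k))"
      by (auto simp: Lam.IH)
    then show "i \<in> r ` free_vars (Lam t)"
      by (cases j) auto
  next
    fix i assume "i \<in> r ` free_vars (Lam t)"
    then obtain j where "Suc j \<in> free_vars t" "i = r j"
      by auto
    then show "i \<in> free_vars (rename r (Lam t))"
      by (auto simp: Lam.IH intro!: image_eqI[of _ _ "Suc j"])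
  qed
qed auto

lemma free_vars_subst: "free_vars (subst \<sigma> t) = (\<Union>i\<in>free_vars t. free_vars (\<sigma> i))"
proof (induction t arbitrary: \<sigma>)
  case (Lam t)
  show ?case
  proof (intro set_eqI iffI)
    fix i assume "i \<in> free_vars (subst \<sigma> (Lam t))"
    then obtain j where "j \<in> free_vars t"
      "Suc i \<in> free_vars (case j of 0 \<Rightarrow> Var 0 | Suc k \<Rightarrow> rename Suc (\<sigma> k))"
      by (auto simp: Lam.IH)
    then show "i \<in> (\<Union>j\<in>free_vars (Lam t). free_vars (\<sigma> j))"
      by (cases j) (auto simp: free_vars_rename)
  next
    fix i assume "i \<in> (\<Union>j\<in>free_vars (Lam t). free_vars (\<sigma> j))"
    then obtain j where "Suc j \<in> free_vars t" "i \<in> free_vars (\<sigma> j)"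
      by auto
    then show "i \<in> free_vars (subst \<sigma> (Lam t))"
      by (auto simp: Lam.IH free_vars_rename intro!: bexI[of _ "Suc j"])
  qed
qed auto

lemma free_vars_Apps: "free_vars (Apps t ts) = free_vars t \<union> (\<Union>u\<in>set ts. free_vars u)"
  by (induction ts arbitrary: t) auto

lemma finite_free_vars: "finite (free_vars t)"
proof (induction t)
  case (Lam t)
  have "{i. Suc i \<in> free_vars t} = Suc -` free_vars t"
    by auto
  then show ?case
    using Lam finite_vimageI[of "free_vars t" Suc] by simp
qed auto

lemma free_vars_headC_step: "headC_step t t' \<Longrightarrow> free_vars t' \<subseteq> free_vars t"
proof (induction rule: headC_step.induct)
  case (head_beta u t ts)
  have "free_vars (subst0 t u) \<subseteq> free_vars (App (Lam u) t)"
    by (auto simp: subst0_def free_vars_subst split: nat.splits)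
  then show ?case
    by (auto simp: free_vars_Apps)
qed (auto simp: free_vars_Apps free_vars_rename)


section \<open>\<open>\<beta>\<close>-equivalence\<close>

lemma beta_equiv_map:
  assumes "beta_equiv t u" and "\<And>t u. beta t u \<Longrightarrow> beta_equiv (h t) (h u)"
  shows "beta_equiv (h t) (h u)"
  using assms(1)
proof (induction rule: equivclp_induct)
  case base
  show ?case by (rule equivclp_refl)
next
  case (step y z)
  then show ?case
    using assms(2)[of y z] assms(2)[of z y] by (blast intro: equivclp_sym equivclp_trans)
qed

lemma beta_equiv_Lam: "beta_equiv t u \<Longrightarrow> beta_equiv (Lam t) (Lam u)"
  by (erule beta_equiv_map) (intro r_into_equivclp beta_Lam)

lemma beta_equiv_App:
  assumes "beta_equiv t t'" and "beta_equiv u u'"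
  shows "beta_equiv (App t u) (App t' u')"
proof -
  have "beta_equiv (App t u) (App t' u)"
    by (rule beta_equiv_map[OF assms(1)]) (intro r_into_equivclp beta_AppL)
  moreover have "beta_equiv (App t' u) (App t' u')"
    by (rule beta_equiv_map[OF assms(2)]) (intro r_into_equivclp beta_AppR)
  ultimately show ?thesis
    by (rule equivclp_trans)
qed

lemma beta_equiv_Apps: "beta_equiv t t' \<Longrightarrow> beta_equiv (Apps t ts) (Apps t' ts)"
  by (induction ts arbitrary: t t') (simp_all add: beta_equiv_App)

lemma beta_subst: "beta t t' \<Longrightarrow> beta (subst \<sigma> t) (subst \<sigma> t')"
  by (induction arbitrary: \<sigma> rule: beta.induct)
    (auto simp: subst_subst0 intro: beta.intros)

lemma beta_equiv_subst: "beta_equiv t t' \<Longrightarrow> beta_equiv (subst \<sigma> t) (subst \<sigma> t')"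
  by (erule beta_equiv_map[where h = "subst \<sigma>"]) (intro r_into_equivclp beta_subst)

text \<open>The \<eta>-expansion of an abstraction \<beta>-reduces to that abstraction, and
  \<open>t\<close> is equivalent to one.\<close>

lemma beta_equiv_Lam_eta:
  assumes "beta_equiv t (Lam u)"
  shows "beta_equiv t (Lam (App (rename Suc t) (Var 0)))"
proof -
  have "beta_equiv (rename Suc t) (rename Suc (Lam u))"
    unfolding rename_eq_subst by (rule beta_equiv_subst) (rule assms)
  then have "beta_equiv (App (rename Suc t) (Var 0)) (App (rename Suc (Lam u)) (Var 0))"
    by (intro beta_equiv_App) auto
  moreover have "beta (App (rename Suc (Lam u)) (Var 0)) u"
  proof -
    have "subst0 (Var 0) (rename (case_nat 0 (\<lambda>i. Suc (Suc i))) u) = u"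
    proof -
      have "case_nat (Var 0) (\<lambda>x. Var (Suc x)) = Var"
        by (auto split: nat.split)
      then show ?thesis
        by (simp add: subst0_def subst_rename case_nat_comp subst_Var)
    qed
    then show ?thesis
      using beta_red[of "rename (case_nat 0 (\<lambda>i. Suc (Suc i))) u" "Var 0"] by simp
  qed
  ultimately have "beta_equiv (App (rename Suc t) (Var 0)) u"
    by (rule equivclp_trans[OF _ r_into_equivclp])
  then show ?thesis
    by (rule equivclp_trans[OF assms equivclp_sym[OF beta_equiv_Lam]])
qed

lemma subst_funpow_App:
  "subst \<sigma> ((App t ^^ n) u) = (App (subst \<sigma> t) ^^ n) (subst \<sigma> u)"
  by (induction n) auto

text \<open>
  Without the assumptions \<open>t\<close> and \<open>t2\<close> the integer would only be \<open>\<beta>\<eta>\<close>-equivalent to \<open>t\<close>.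
\<close>

lemma beta_equiv_church:
  assumes fresh: "free_vars t \<inter> {2, 3} = {}"
    and t: "(\<exists>u. beta_equiv t (Lam u)) \<or> beta_equiv t (Var 3)"
    and t2: "(\<exists>u. beta_equiv (App t (Var 2)) (Lam u)) \<or> beta_equiv (App t (Var 2)) (Var 3)"
    and t23: "beta_equiv (App (App t (Var 2)) (Var 3)) ((App (Var 3) ^^ n) (Var 2))"
  shows "beta_equiv t (church n)"
proof -
  have fresh': "i \<noteq> 2 \<and> i \<noteq> 3" if "i \<in> free_vars t" for i
    using fresh that by auto
  have inst: "subst \<sigma> t = t" if "\<And>i. i \<noteq> 2 \<Longrightarrow> i \<noteq> 3 \<Longrightarrow> \<sigma> i = Var i" for \<sigma>
    using subst_cong[of t \<sigma> Var] fresh' that by (simp add: subst_Var)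
  have shift: "subst \<sigma> t = (rename Suc ^^ k) t"
    if "\<And>i. i \<noteq> 2 \<Longrightarrow> i \<noteq> 3 \<Longrightarrow> \<sigma> i = Var (i + k)" for \<sigma> k
  proof -
    have "(rename Suc ^^ k) t = rename (\<lambda>i. i + k) t"
    proof (induction k)
      case 0
      then show ?case by (simp add: rename_eq_subst subst_Var)
    qed (simp add: rename_rename)
    then show ?thesis
      using subst_cong[of t \<sigma> "\<lambda>i. Var (i + k)"] fresh' that by (simp add: rename_eq_subst)
  qed
  have "\<exists>u. beta_equiv t (Lam u)"
    using t
  proof
    \<comment> \<open>Since \<open>Var 3\<close> is not free in \<open>t\<close>, replacing it by an
      abstraction leaves \<open>t\<close> unchanged and turns the right-hand side into an
      abstraction.\<close>
    assume "beta_equiv t (Var 3)"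
    then have "beta_equiv (subst (Var(3 := Lam (Var 0))) t) (Lam (Var 0))"
      using beta_equiv_subst[of t "Var 3" "Var(3 := Lam (Var 0))"] by simp
    then show ?thesis
      by (auto simp: inst)
  qed
  then have eq1: "beta_equiv t (Lam (App (rename Suc t) (Var 0)))"
    using beta_equiv_Lam_eta by blast
  have "\<exists>u. beta_equiv (App (rename Suc t) (Var 0)) (Lam u)"
  proof -
    \<comment> \<open>The other variables are shifted past one new binder; \<open>Var 2\<close>
      becomes the bound variable and \<open>Var 3\<close> again an abstraction.\<close>
    let ?\<sigma> = "(\<lambda>i. Var (Suc i))(2 := Var 0, 3 := Lam (Var 0))"
    have "subst ?\<sigma> t = (rename Suc ^^ 1) t"
      by (rule shift) auto
    then have "subst ?\<sigma> (App t (Var 2)) = App (rename Suc t) (Var 0)"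
      by simp
    moreover have "\<exists>u. beta_equiv (subst ?\<sigma> (App t (Var 2))) (Lam u)"
      using t2
    proof
      assume "beta_equiv (App t (Var 2)) (Var 3)"
      from beta_equiv_subst[OF this, of ?\<sigma>] show ?thesis
        by auto
    next
      assume "\<exists>u. beta_equiv (App t (Var 2)) (Lam u)"
      then obtain u where "beta_equiv (App t (Var 2)) (Lam u)"
        by blast
      from beta_equiv_subst[OF this, of ?\<sigma>] show ?thesis
        by auto
    qed
    ultimately show ?thesis
      by simp
  qed
  then have "beta_equiv (App (rename Suc t) (Var 0))
      (Lam (App (rename Suc (App (rename Suc t) (Var 0))) (Var 0)))"
    using beta_equiv_Lam_eta by blast
  then have eq2: "beta_equiv (App (rename Suc t) (Var 0))
      (Lam (App (App (rename Suc (rename Suc t)) (Var 1)) (Var 0)))"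
    by simp
  \<comment> \<open>The fresh variables become the two variables bound by the integer, the outer
    \<open>x\<close> being \<open>Var 1\<close> and the inner \<open>f\<close> being
    \<open>Var 0\<close>.\<close>
  let ?\<sigma> = "(\<lambda>i. Var (i + 2))(2 := Var 1, 3 := Var 0)"
  have "subst ?\<sigma> t = (rename Suc ^^ 2) t"
    by (rule shift) auto
  then have "subst ?\<sigma> t = rename Suc (rename Suc t)"
    by (simp add: numeral_2_eq_2)
  then have "beta_equiv (App (App (rename Suc (rename Suc t)) (Var 1)) (Var 0))
      ((App (Var 0) ^^ n) (Var 1))"
    using beta_equiv_subst[OF t23, of ?\<sigma>] by (simp add: subst_funpow_App)
  then show ?thesis
    unfolding church_def
    by (intro equivclp_trans[OF eq1 beta_equiv_Lam] equivclp_trans[OF eq2 beta_equiv_Lam])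
qed


section \<open>Consequences of equations as a congruence\<close>

lemma tsubst_tsubst: "tsubst \<eta> (tsubst \<sigma> t) = tsubst (\<lambda>i. tsubst \<eta> (\<sigma> i)) t"
  by (induction t) auto

lemma tsubst_TVar: "tsubst TVar t = t"
  by (induction t) (auto intro: map_idI)

lemma wf_tm_tsubst: "wf_tm L t \<Longrightarrow> (\<And>i. wf_tm L (\<sigma> i)) \<Longrightarrow> wf_tm L (tsubst \<sigma> t)"
  by (induction t) auto

text \<open>A first-order form of the relation \<approx>, as the congruence generated by
  \<open>E\<close>, which the predicates of a model can be required to respect.\<close>

inductive approx ::
  "('f, 'p) language \<Rightarrow> ('f fotm \<times> 'f fotm) set \<Rightarrow> 'f fotm \<Rightarrow> 'f fotm \<Rightarrow> bool"
  for L :: "('f, 'p) language" and E :: "('f fotm \<times> 'f fotm) set" where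
  approx_inst: "(u, v) \<in> E \<Longrightarrow> \<forall>i. wf_tm L (\<sigma> i) \<Longrightarrow> approx L E (tsubst \<sigma> u) (tsubst \<sigma> v)"
| approx_refl: "approx L E u u"
| approx_sym: "approx L E u v \<Longrightarrow> approx L E v u"
| approx_trans: "approx L E u v \<Longrightarrow> approx L E v w \<Longrightarrow> approx L E u w"
| approx_Fn: "approx L E u v \<Longrightarrow> approx L E (Fn f (us @ u # vs)) (Fn f (us @ v # vs))"

lemma approx_Fn_list:
  assumes "list_all2 (approx L E) us vs"
  shows "approx L E (Fn f us) (Fn f vs)"
proof -
  have "approx L E (Fn f (ws @ us)) (Fn f (ws @ vs))" for ws
    using assms
  proof (induction arbitrary: ws rule: list_all2_induct)
    case Nil
    then show ?case by (simp add: approx_refl)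
  next
    case (Cons u us v vs)
    have "approx L E (Fn f (ws @ u # us)) (Fn f (ws @ v # us))"
      using Cons.hyps(1) by (rule approx_Fn)
    also have "approx L E (Fn f (ws @ v # us)) (Fn f (ws @ v # vs))"
      using Cons.IH[of "ws @ [v]"] by simp
    finally (approx_trans) show ?case .
  qed
  from this[of "[]"] show ?thesis by simp
qed

lemma approx_suc_tm: "approx L E a b \<Longrightarrow> approx L E (suc_tm L a) (suc_tm L b)"
  unfolding suc_tm_def by (rule approx_Fn_list) simp

lemma approx_tsubst:
  "(\<And>i. approx L E (\<eta> i) (\<eta>' i)) \<Longrightarrow> approx L E (tsubst \<eta> t) (tsubst \<eta>' t)"
proof (induction t)
  case (Fn f ts)
  then have "list_all2 (approx L E) (map (tsubst \<eta>) ts) (map (tsubst \<eta>') ts)"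
    by (auto simp: list_all2_conv_all_nth)
  then show ?case
    by (simp add: approx_Fn_list)
qed simp

lemma deducible_Eqn_refl:
  assumes "wf_tm L u"
  shows "deducible L E [] (Eqn u u)"
  unfolding Eqn_def
  by (rule d_All2I, rule d_ImpI, rule d_hyp) (use assms in auto)

text \<open>The predicate variable of \<open>Eqn u v\<close> is instantiated with the equation
  \<open>Eqn a b\<close>, in which index 0 is the hole. Suitable \<open>a\<close> and
  \<open>b\<close> give symmetry, transitivity and congruence.\<close>

lemma leibniz:
  fixes L :: "('f, 'p) language" and u v :: "'f fotm"
  assumes uv: "deducible L E [] (Eqn u v)" and wf: "wf_tm L a" "wf_tm L b"
    and ab: "deducible L E [] (Eqn (tsubst (case_nat u TVar) a) (tsubst (case_nat u TVar) b))"
  shows "deducible L E [] (Eqn (tsubst (case_nat v TVar) a) (tsubst (case_nat v TVar) b))"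
proof -
  let ?G = "Eqn a b :: ('f, 'p) fm"
  have abs_inst: "abs_inst [w] G = fsubst (case_nat w TVar) G" for w and G :: "('f, 'p) fm"
  proof -
    have "(\<lambda>j. if j < length [w] then [w] ! j else TVar (j - length [w])) = case_nat w TVar"
      by (auto split: nat.split)
    then show ?thesis
      by (simp only: abs_inst_def)
  qed
  have "deducible L E [] (pinst Ordinary 1 ?G (Imp (PVar Ordinary 0 [u]) (PVar Ordinary 0 [v])))"
    using uv unfolding Eqn_def by (rule d_All2E) (use wf in auto)
  then have "deducible L E []
      (Imp (Eqn (tsubst (case_nat u TVar) a) (tsubst (case_nat u TVar) b))
        (Eqn (tsubst (case_nat v TVar) a) (tsubst (case_nat v TVar) b)))"
    by (simp add: pinst_def abs_inst Eqn_def)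
  then show ?thesis
    using ab by (rule d_ImpE)
qed

text \<open>Invariance of well-formedness is part of the induction because, for symmetry and
  transitivity, the left-hand side of a hypothesis is known to be well-formed only through
  it.\<close>

lemma approx_deducible:
  assumes "wf_equations L E" and "approx L E u v"
  shows "(wf_tm L u \<longleftrightarrow> wf_tm L v) \<and> (wf_tm L u \<longrightarrow> deducible L E [] (Eqn u v))"
proof -
  \<comment> \<open>\<open>up\<close> frees index 0 for the hole of \<open>leibniz\<close>; filling
    the hole restores the original term.\<close>
  define up :: "'a fotm \<Rightarrow> 'a fotm" where "up = tsubst (\<lambda>i. TVar (Suc i))"
  have up: "tsubst (case_nat w TVar) (up t) = t" for w t
    by (simp add: up_def tsubst_tsubst tsubst_TVar)
  have up_map: "map (tsubst (case_nat w TVar)) (map up ts) = ts" for w ts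
    by (simp add: map_idI up)
  have wf_up: "wf_tm L t \<Longrightarrow> wf_tm L (up t)" for t
    unfolding up_def by (rule wf_tm_tsubst) auto
  show ?thesis
    using assms(2)
  proof (induction rule: approx.induct)
    case (approx_inst u v \<sigma>)
    then have "wf_tm L (tsubst \<sigma> u)" "wf_tm L (tsubst \<sigma> v)"
      using assms(1) by (auto simp: wf_equations_def intro!: wf_tm_tsubst)
    moreover have "deducible L E [] (Eqn (tsubst \<sigma> u) (tsubst \<sigma> v))"
      using approx_inst by (intro d_equation) auto
    ultimately show ?case by simp
  next
    case (approx_refl u)
    then show ?case
      by (simp add: deducible_Eqn_refl)
  next
    case (approx_sym u v)
    have "deducible L E [] (Eqn v u)" if "wf_tm L u"
      using leibniz[of L E u v "TVar 0" "up u"] approx_sym.IH that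
      by (simp add: up wf_up deducible_Eqn_refl)
    then show ?case
      using approx_sym.IH by simp
  next
    case (approx_trans u v w)
    have "deducible L E [] (Eqn u w)" if "wf_tm L u"
      using leibniz[of L E v w "up u" "TVar 0"] approx_trans.IH that
      by (simp add: up wf_up)
    then show ?case
      using approx_trans.IH by simp
  next
    case (approx_Fn u v f us vs)
    have "deducible L E [] (Eqn (Fn f (us @ u # vs)) (Fn f (us @ v # vs)))"
      if "wf_tm L (Fn f (us @ u # vs))"
    proof -
      have "wf_tm L (Fn f (map up us @ up u # map up vs))"
        "wf_tm L (Fn f (map up us @ TVar 0 # map up vs))"
        using that by (auto simp: wf_up)
      then show ?thesis
        using leibniz[of L E u v "Fn f (map up us @ up u # map up vs)"
            "Fn f (map up us @ TVar 0 # map up vs)"] approx_Fn.IH that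
        by (simp add: up up_map deducible_Eqn_refl del: map_map)
    qed
    then show ?case
      using approx_Fn.IH by auto
  qed
qed

lemma approx_eq_conseq:
  "wf_equations L E \<Longrightarrow> approx L E u v \<Longrightarrow> wf_tm L u \<Longrightarrow> eq_conseq L E u v"
  using approx_deducible by (fastforce simp: eq_conseq_def)


section \<open>Interpretations of formulas\<close>

text \<open>The environment for a formula that replaces a \<open>k\<close>-ary predicate variable:
  its distinguished indices denote the arguments \<open>as\<close>.\<close>

definition insert_env :: "nat \<Rightarrow> 'a list \<Rightarrow> (nat \<Rightarrow> 'a) \<Rightarrow> nat \<Rightarrow> 'a" where
  "insert_env k as \<eta> j = (if j < k then as ! j else \<eta> (j - k))"

definition push :: "kind \<Rightarrow> nat \<Rightarrow> 'r \<Rightarrow> (kind \<Rightarrow> nat \<Rightarrow> nat \<Rightarrow> 'r) \<Rightarrow> kind \<Rightarrow> nat \<Rightarrow> nat \<Rightarrow> 'r" where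
  "push \<kappa> k R S = (\<lambda>\<kappa>' k'. if \<kappa>' = \<kappa> \<and> k' = k then case_nat R (S \<kappa> k) else S \<kappa>' k')"

lemma push_apply:
  "push \<kappa> k R S \<kappa>' k' i = (if \<kappa>' = \<kappa> \<and> k' = k then case_nat R (S \<kappa> k) i else S \<kappa>' k' i)"
  by (simp add: push_def)

text \<open>Common frame for the two-valued model that analyses \<open>E\<close> and for the
  realizability models. As for types, an implication takes the kind of its conclusion.\<close>

locale truth_values =
  fixes L :: "('f, 'p) language" and E :: "('f fotm \<times> 'f fotm) set"
    and arr :: "'e set \<Rightarrow> 'e set \<Rightarrow> 'e set"
    and bot :: "'e set"
    and Val :: "kind \<Rightarrow> 'e set set"
  assumes bot_Val: "bot \<in> Val Classical"
    and Val_Ordinary: "S \<in> Val \<kappa> \<Longrightarrow> S \<in> Val Ordinary"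
    and arr_Val: "S \<in> Val Ordinary \<Longrightarrow> T \<in> Val \<kappa> \<Longrightarrow> arr S T \<in> Val \<kappa>"
    and Inter_Val: "F \<subseteq> Val \<kappa> \<Longrightarrow> \<Inter>F \<in> Val \<kappa>"
begin

text \<open>Individuals are terms; invariance under \<open>approx\<close> takes the place of a
  quotient and makes the equational rule sound.\<close>

definition Pred :: "kind \<Rightarrow> ('f fotm list \<Rightarrow> 'e set) set" where
  "Pred \<kappa> = {R. (\<forall>as. R as \<in> Val \<kappa>) \<and>
     (\<forall>as bs. list_all2 (approx L E) as bs \<longrightarrow> R as = R bs)}"

lemma Pred_Val: "R \<in> Pred \<kappa> \<Longrightarrow> R as \<in> Val \<kappa>"
  unfolding Pred_def by blast

lemma Pred_approx: "R \<in> Pred \<kappa> \<Longrightarrow> list_all2 (approx L E) as bs \<Longrightarrow> R as = R bs"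
  unfolding Pred_def by blast

lemma PredI:
  assumes "\<And>as. R as \<in> Val \<kappa>" and "\<And>as bs. list_all2 (approx L E) as bs \<Longrightarrow> R as \<subseteq> R bs"
  shows "R \<in> Pred \<kappa>"
proof -
  have "list_all2 (approx L E) bs as" if "list_all2 (approx L E) as bs" for as bs
    using that by (auto simp: list_all2_conv_all_nth intro: approx_sym)
  then have "R as = R bs" if "list_all2 (approx L E) as bs" for as bs
    using that assms(2) by (meson subset_antisym)
  then show ?thesis
    unfolding Pred_def using assms(1) by blast
qed

text \<open>Predicate symbols get the default value \<open>bot\<close>. First-order quantifiers
  range over well-formed terms, to which equational consequence and hence adequacy are
  confined.\<close>

primrec interp ::
  "('f, 'p) fm \<Rightarrow> (nat \<Rightarrow> 'f fotm) \<Rightarrow> (kind \<Rightarrow> nat \<Rightarrow> nat \<Rightarrow> 'f fotm list \<Rightarrow> 'e set) \<Rightarrow> 'e set"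
where
  "interp Bot \<eta> S = bot"
| "interp (Rel P ts) \<eta> S = bot"
| "interp (PVar \<kappa> i ts) \<eta> S = S \<kappa> (length ts) i (map (tsubst \<eta>) ts)"
| "interp (Imp A B) \<eta> S = arr (interp A \<eta> S) (interp B \<eta> S)"
| "interp (All1 A) \<eta> S = (\<Inter>d\<in>{d. wf_tm L d}. interp A (case_nat d \<eta>) S)"
| "interp (All2 \<kappa> k A) \<eta> S = (\<Inter>R\<in>Pred \<kappa>. interp A \<eta> (push \<kappa> k R S))"

lemma interp_fsubst: "interp (fsubst \<sigma> A) \<eta> S = interp A (\<lambda>i. tsubst \<eta> (\<sigma> i)) S"
  by (induction A arbitrary: \<sigma> \<eta> S) (simp_all add: tsubst_tsubst case_nat_comp o_def)

lemma interp_flift: "interp (flift A) (case_nat d \<eta>) S = interp A \<eta> S"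
  by (simp add: flift_def interp_fsubst)

lemma interp_finst: "interp (finst u A) \<eta> S = interp A (case_nat (tsubst \<eta> u) \<eta>) S"
  by (simp add: finst_def interp_fsubst case_nat_comp)

lemma interp_prename:
  "interp (prename r A) \<eta> S = interp A \<eta> (\<lambda>\<kappa> k i. S \<kappa> k (r \<kappa> k i))"
proof (induction A arbitrary: r \<eta> S)
  case (All2 \<kappa> k A)
  have "(\<lambda>\<kappa>' k' i. push \<kappa> k R S \<kappa>' k'
        ((if \<kappa>' = \<kappa> \<and> k' = k then case_nat 0 (\<lambda>i. Suc (r \<kappa> k i)) else r \<kappa>' k') i)) =
      push \<kappa> k R (\<lambda>\<kappa> k i. S \<kappa> k (r \<kappa> k i))" for R
    by (auto simp: push_apply fun_eq_iff split: nat.split)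
  then show ?case
    by (simp add: All2.IH)
qed simp_all

lemma interp_plift: "interp (plift \<kappa> k A) \<eta> (push \<kappa> k R S) = interp A \<eta> S"
proof -
  have "(\<lambda>\<kappa>' k' i. push \<kappa> k R S \<kappa>' k' ((if \<kappa>' = \<kappa> \<and> k' = k then Suc i else i))) = S"
    by (auto simp: push_apply fun_eq_iff)
  then show ?thesis
    by (simp add: plift_def interp_prename)
qed

text \<open>The arity of an occurrence is the length of its argument list, and
  \<open>abs_pvar\<close> denotes the variable itself only on lists of the right length.\<close>

lemma interp_cong:
  "(\<And>\<kappa> k i as. length as = k \<Longrightarrow> S \<kappa> k i as = S' \<kappa> k i as) \<Longrightarrow> interp A \<eta> S = interp A \<eta> S'"
proof (induction A arbitrary: \<eta> S S')
  case (Imp A B)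
  show ?case
    using Imp.IH[of S S'] Imp.prems by simp
next
  case (All1 A)
  show ?case
    using All1.IH[of S S'] All1.prems by simp
next
  case (All2 \<kappa> k A)
  have "interp A \<eta> (push \<kappa> k R S) = interp A \<eta> (push \<kappa> k R S')" for R
    by (rule All2.IH) (auto simp: push_apply All2.prems split: nat.split)
  then show ?case
    by simp
qed simp_all

lemma interp_psubst:
  "interp (psubst \<Sigma> A) \<eta> S = interp A \<eta> (\<lambda>\<kappa> k i as. interp (\<Sigma> \<kappa> k i) (insert_env k as \<eta>) S)"
proof (induction A arbitrary: \<Sigma> \<eta> S)
  case (PVar \<kappa> i ts)
  have "(\<lambda>j. tsubst \<eta> (if j < length ts then ts ! j else TVar (j - length ts))) =
      insert_env (length ts) (map (tsubst \<eta>) ts) \<eta>"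
    by (auto simp: insert_env_def)
  then show ?case
    by (simp add: abs_inst_def interp_fsubst)
next
  case (All1 A)
  have "interp (abs_flift k G) (insert_env k as (case_nat d \<eta>)) S =
      interp G (insert_env k as \<eta>) S" for G as d k
  proof -
    have "(\<lambda>j. tsubst (insert_env k as (case_nat d \<eta>)) (TVar (if j < k then j else Suc j))) =
        insert_env k as \<eta>"
      by (auto simp: insert_env_def fun_eq_iff Suc_diff_le)
    then show ?thesis
      by (simp only: abs_flift_def interp_fsubst)
  qed
  then show ?case
    by (simp add: All1.IH)
next
  case (All2 \<kappa> k A)
  have abs_pvar: "interp (abs_pvar \<kappa> k 0) (insert_env k as \<eta>) (push \<kappa> k R S) = R as"
    if "length as = k" for as R
  proof -
    have "map (insert_env k as \<eta>) [0..<k] = as"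
      using that by (intro nth_equalityI) (auto simp: insert_env_def)
    then show ?thesis
      by (simp add: abs_pvar_def push_apply o_def)
  qed
  show ?case
    unfolding psubst.simps interp.simps All2.IH
    by (intro INF_cong refl interp_cong)
      (auto simp: push_apply abs_pvar interp_plift split: nat.split)
qed simp_all

lemma interp_pinst:
  "interp (pinst \<kappa> k G A) \<eta> S = interp A \<eta> (push \<kappa> k (\<lambda>as. interp G (insert_env k as \<eta>) S) S)"
proof -
  have abs_pvar: "interp (abs_pvar \<kappa>' k' i) (insert_env k' as \<eta>) S = S \<kappa>' k' i as"
    if "length as = k'" for as \<kappa>' k' i
  proof -
    have "map (insert_env k' as \<eta>) [0..<k'] = as"
      using that by (intro nth_equalityI) (auto simp: insert_env_def)
    then show ?thesis
      by (simp add: abs_pvar_def o_def)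
  qed
  show ?thesis
    unfolding pinst_def interp_psubst
    by (rule interp_cong) (auto simp: push_apply abs_pvar split: nat.split)
qed

section \<open>Truth values of types under valid assignments\<close>

definition valid :: "(kind \<Rightarrow> nat \<Rightarrow> nat \<Rightarrow> 'f fotm list \<Rightarrow> 'e set) \<Rightarrow> bool" where
  "valid S \<longleftrightarrow> (\<forall>\<kappa> k i. S \<kappa> k i \<in> Pred \<kappa>)"

lemma valid_push: "valid S \<Longrightarrow> R \<in> Pred \<kappa> \<Longrightarrow> valid (push \<kappa> k R S)"
  by (auto simp: valid_def push_apply split: nat.split)

text \<open>The second claim admits classical types as values of classical variables. The first is
  needed along with it for the premise of an implication.\<close>

lemma interp_Val:
  assumes "valid S"
  shows "interp A \<eta> S \<in> Val Ordinary" and "classical_type A \<Longrightarrow> interp A \<eta> S \<in> Val Classical"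
  using assms
proof (induction A arbitrary: \<eta> S)
  case (PVar \<kappa> i ts)
  have Val: "valid S \<Longrightarrow> interp (PVar \<kappa> i ts) \<eta> S \<in> Val \<kappa>" for \<eta> S
    by (simp add: valid_def Pred_Val)
  { case 1 then show ?case by (rule Val_Ordinary[OF Val]) }
  { case 2 then show ?case using Val by simp }
next
  case (All1 A)
  { case 1 then show ?case using All1.IH(1) by (auto intro!: Inter_Val) }
  { case 2 then show ?case using All1.IH(2) by (auto intro!: Inter_Val) }
next
  case (All2 \<kappa> k A)
  { case 1 then show ?case using All2.IH(1) by (auto intro!: Inter_Val valid_push) }
  { case 2 then show ?case using All2.IH(2) by (auto intro!: Inter_Val valid_push) }
qed (auto intro: bot_Val Val_Ordinary arr_Val)

lemma interp_approx:
  "valid S \<Longrightarrow> (\<And>i. approx L E (\<eta> i) (\<eta>' i)) \<Longrightarrow> interp A \<eta> S = interp A \<eta>' S"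
proof (induction A arbitrary: \<eta> \<eta>' S)
  case (PVar \<kappa> i ts)
  then have "list_all2 (approx L E) (map (tsubst \<eta>) ts) (map (tsubst \<eta>') ts)"
    by (auto simp: list_all2_conv_all_nth intro: approx_tsubst)
  then show ?case
    using Pred_approx[of "S \<kappa> (length ts) i" \<kappa>] PVar.prems(1) by (simp add: valid_def)
next
  case (Imp A B)
  show ?case
    using Imp.IH[OF Imp.prems] by simp
next
  case (All1 A)
  have "interp A (case_nat d \<eta>) S = interp A (case_nat d \<eta>') S" for d
    using All1.prems by (intro All1.IH) (auto simp: approx_refl split: nat.split)
  then show ?case
    by simp
next
  case (All2 \<kappa> k A)
  have "interp A \<eta> (push \<kappa> k R S) = interp A \<eta>' (push \<kappa> k R S)" if "R \<in> Pred \<kappa>" for R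
    using All2.prems that by (intro All2.IH valid_push)
  then show ?case
    by simp
qed simp_all

lemma interp_Pred:
  assumes "valid S" and "\<And>as. interp G (insert_env k as \<eta>) S \<in> Val \<kappa>"
  shows "(\<lambda>as. interp G (insert_env k as \<eta>) S) \<in> Pred \<kappa>"
proof -
  have "interp G (insert_env k as \<eta>) S = interp G (insert_env k bs \<eta>) S"
    if "list_all2 (approx L E) as bs" for as bs
  proof (rule interp_approx)
    fix i
    show "approx L E (insert_env k as \<eta> i) (insert_env k bs \<eta> i)"
    proof (cases "i < length as")
      case True
      then show ?thesis
        using that by (simp add: insert_env_def approx_refl list_all2_conv_all_nth)
    next
      case False
      \<comment> \<open>The lists may be shorter than \<open>k\<close>. Beyond the end, the
        unspecified value of \<open>nth\<close> depends only on the excess of the index, so lists of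
        equal length agree there.\<close>
      have "xs ! j = [] ! (j - length xs)" if "length xs \<le> j" for xs :: "'f fotm list" and j
        using that
      proof (induction xs arbitrary: j)
        case (Cons x xs)
        then show ?case by (cases j) simp_all
      qed simp
      from this[of as i] this[of bs i] have "as ! i = bs ! i"
        using False list_all2_lengthD[OF that] by simp
      then show ?thesis
        by (simp add: insert_env_def approx_refl)
    qed
  qed (rule assms(1))
  then show ?thesis
    using assms(2) by (auto simp: Pred_def)
qed

end

text \<open>Deduction is sound in the Boolean model whose truth values are the subsets of
  \<open>unit\<close>, where the equation is tested on the predicate of being congruent to the
  left-hand side.\<close>

lemma eq_conseq_approx:
  assumes "eq_conseq L E u v" and "\<And>i. wf_tm L (\<eta> i)"
  shows "approx L E (tsubst \<eta> u) (tsubst \<eta> v)"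
proof -
  interpret truth_values L E "\<lambda>S T. - S \<union> T" "{}" "\<lambda>_. UNIV :: unit set set"
    by unfold_locales auto
  have sound: "() \<in> interp A \<eta> S"
    if "deducible L E \<Gamma> A" "\<And>i. wf_tm L (\<eta> i)" "valid S" "\<And>B. B \<in> set \<Gamma> \<Longrightarrow> () \<in> interp B \<eta> S"
    for \<Gamma> A \<eta> S
    using that
  proof (induction arbitrary: \<eta> S rule: deducible.induct)
    case (d_equation u v \<sigma> \<Gamma>)
    have "approx L E (tsubst \<eta> (tsubst \<sigma> u)) (tsubst \<eta> (tsubst \<sigma> v))"
      unfolding tsubst_tsubst
      using d_equation by (auto intro!: approx_inst wf_tm_tsubst)
    then have "R [tsubst \<eta> (tsubst \<sigma> u)] = R [tsubst \<eta> (tsubst \<sigma> v)]"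
      if "R \<in> Pred Ordinary" for R
      using Pred_approx[OF that, of "[_]" "[_]"] by simp
    then show ?case
      by (auto simp: Eqn_def push_apply)
  next
    case (d_All1I \<Gamma> A)
    have "() \<in> interp A (case_nat d \<eta>) S" if "wf_tm L d" for d
      using d_All1I.prems that
      by (intro d_All1I.IH) (auto simp: interp_flift split: nat.split)
    then show ?case by simp
  next
    case (d_All1E \<Gamma> A u)
    have "() \<in> interp (All1 A) \<eta> S"
      using d_All1E.prems by (intro d_All1E.IH) auto
    moreover have "wf_tm L (tsubst \<eta> u)"
      using d_All1E by (intro wf_tm_tsubst) auto
    ultimately show ?case
      by (simp add: interp_finst)
  next
    case (d_All2I k \<Gamma> A)
    have "() \<in> interp A \<eta> (push Ordinary k R S)" if "R \<in> Pred Ordinary" for R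
      using d_All2I.prems that
      by (intro d_All2I.IH) (auto simp: interp_plift intro: valid_push)
    then show ?case by simp
  next
    case (d_All2E \<Gamma> k A G)
    have "() \<in> interp (All2 Ordinary k A) \<eta> S"
      using d_All2E.prems by (intro d_All2E.IH) auto
    moreover have "(\<lambda>as. interp G (insert_env k as \<eta>) S) \<in> Pred Ordinary"
      using d_All2E.prems by (intro interp_Pred) auto
    ultimately show ?case
      by (simp add: interp_pinst)
  next
    case (d_ImpI A \<Gamma> B)
    show ?case
      using d_ImpI.IH[of \<eta> S] d_ImpI.prems by auto
  next
    case (d_ImpE \<Gamma> A B)
    show ?case
      using d_ImpE.IH(1)[of \<eta> S] d_ImpE.IH(2)[of \<eta> S] d_ImpE.prems by auto
  qed auto
  define R where "R as = {x :: unit. \<exists>b. as = [b] \<and> approx L E (tsubst \<eta> u) b}" for as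
  have R: "R \<in> Pred Ordinary"
  proof (rule PredI)
    fix as bs :: "'a fotm list" assume "list_all2 (approx L E) as bs"
    then show "R as \<subseteq> R bs"
      by (auto simp: R_def list_all2_Cons1) (rule approx_trans)
  qed simp
  have "valid (\<lambda>_ _ _ _. {})"
    by (auto simp: valid_def Pred_def)
  then have "() \<in> interp (Eqn u v) \<eta> (\<lambda>_ _ _ _. {})"
    using assms by (intro sound[of "[]" "Eqn u v"]) (auto simp: eq_conseq_def)
  then have "() \<in> - R [tsubst \<eta> u] \<union> R [tsubst \<eta> v]"
    using R by (auto simp: Eqn_def push_apply)
  then show ?thesis
    by (simp add: R_def approx_refl split: if_splits)
qed

section \<open>Adequacy of realizability for the type system\<close>

locale realizability_model = truth_values L E arr bot Val
  for L :: "('f, 'p) language" and E and arr :: "'e set \<Rightarrow> 'e set \<Rightarrow> 'e set" and bot and Val +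
  fixes emb :: "trm \<Rightarrow> 'e"
  assumes realizes_C: "S \<in> Val Classical \<Longrightarrow> emb CC \<in> arr (arr (arr S bot) bot) S"
    and realizes_Lam: "S \<in> Val Ordinary \<Longrightarrow> T \<in> Val Ordinary \<Longrightarrow>
      (\<And>u. emb u \<in> S \<Longrightarrow> emb (subst0 u t) \<in> T) \<Longrightarrow> emb (Lam t) \<in> arr S T"
    and realizes_App: "emb t \<in> arr S T \<Longrightarrow> emb u \<in> S \<Longrightarrow> emb (App t u) \<in> T"
begin

lemma M2_sound:
  assumes "M2 L E \<Gamma> t A" and "\<And>i. wf_tm L (\<eta> i)" and "valid S"
    and "\<And>i. i < length \<Gamma> \<Longrightarrow> emb (\<rho> i) \<in> interp (\<Gamma> ! i) \<eta> S"
  shows "emb (subst \<rho> t) \<in> interp A \<eta> S"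
  using assms
proof (induction arbitrary: \<eta> S \<rho> rule: M2.induct)
  case (M2_C \<Gamma>)
  have "emb CC \<in> arr (arr (arr (R []) bot) bot) (R [])" if "R \<in> Pred Classical" for R
    using that by (intro realizes_C Pred_Val)
  then show ?case
    by (simp add: push_apply)
next
  case (M2_Var i \<Gamma>)
  then show ?case by simp
next
  case (M2_Lam A \<Gamma> t B)
  have "emb (subst0 u (subst (case_nat (Var 0) (\<lambda>i. rename Suc (\<rho> i))) t)) \<in> interp B \<eta> S"
    if "emb u \<in> interp A \<eta> S" for u
    unfolding subst0_subst_up using M2_Lam.prems that
    by (intro M2_Lam.IH) (auto simp: nth_Cons split: nat.split)
  then have "emb (Lam (subst (case_nat (Var 0) (\<lambda>i. rename Suc (\<rho> i))) t))
      \<in> arr (interp A \<eta> S) (interp B \<eta> S)"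
    using M2_Lam.prems(2) by (intro realizes_Lam interp_Val)
  then show ?case
    by simp
next
  case (M2_App \<Gamma> u A B v)
  show ?case
    using realizes_App[of "subst \<rho> u" "interp A \<eta> S" "interp B \<eta> S" "subst \<rho> v"]
      M2_App.IH(1)[of \<eta> S \<rho>] M2_App.IH(2)[of \<eta> S \<rho>] M2_App.prems
    by simp
next
  case (M2_All1I \<Gamma> t A)
  have "emb (subst \<rho> t) \<in> interp A (case_nat d \<eta>) S" if "wf_tm L d" for d
    using M2_All1I.prems that
    by (intro M2_All1I.IH) (auto simp: interp_flift split: nat.split)
  then show ?case by simp
next
  case (M2_All1E \<Gamma> t A u)
  have "emb (subst \<rho> t) \<in> interp (All1 A) \<eta> S"
    by (rule M2_All1E.IH[OF M2_All1E.prems])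
  moreover have "wf_tm L (tsubst \<eta> u)"
    using M2_All1E by (intro wf_tm_tsubst) auto
  ultimately show ?case
    by (simp add: interp_finst)
next
  case (M2_All2I \<kappa> k \<Gamma> t A)
  have "emb (subst \<rho> t) \<in> interp A \<eta> (push \<kappa> k R S)" if "R \<in> Pred \<kappa>" for R
    using M2_All2I.prems that
    by (intro M2_All2I.IH) (auto simp: interp_plift intro: valid_push)
  then show ?case by simp
next
  case (M2_All2E \<Gamma> t k A G)
  have "emb (subst \<rho> t) \<in> interp (All2 Ordinary k A) \<eta> S"
    by (rule M2_All2E.IH[OF M2_All2E.prems])
  moreover have "(\<lambda>as. interp G (insert_env k as \<eta>) S) \<in> Pred Ordinary"
    using M2_All2E.prems by (intro interp_Pred interp_Val)
  ultimately show ?case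
    by (simp add: interp_pinst)
next
  case (M2_All2E_classical \<Gamma> t k A G)
  have "emb (subst \<rho> t) \<in> interp (All2 Classical k A) \<eta> S"
    by (rule M2_All2E_classical.IH[OF M2_All2E_classical.prems])
  moreover have "(\<lambda>as. interp G (insert_env k as \<eta>) S) \<in> Pred Classical"
    using M2_All2E_classical.prems M2_All2E_classical.hyps by (intro interp_Pred interp_Val)
  ultimately show ?case
    by (simp add: interp_pinst)
next
  case (M2_eq \<Gamma> t u A v)
  have "approx L E (tsubst \<eta> u) (tsubst \<eta> v)"
    using M2_eq by (intro eq_conseq_approx)
  then have "interp A (case_nat (tsubst \<eta> u) \<eta>) S = interp A (case_nat (tsubst \<eta> v) \<eta>) S"
    using M2_eq.prems by (intro interp_approx) (auto simp: approx_refl split: nat.split)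
  then show ?case
    using M2_eq.IH[OF M2_eq.prems] by (simp add: interp_finst)
qed

lemma M2_sound_closed:
  assumes "M2 L E [] t A" and "closed_trm t" and "\<And>i. wf_tm L (\<eta> i)" and "valid S"
  shows "emb t \<in> interp A \<eta> S"
  using M2_sound[OF assms(1,3,4), of Var] by (simp add: subst_Var)

end


section \<open>The realizability model of a pole\<close>

definition orth :: "trm set \<Rightarrow> trm list set \<Rightarrow> trm set" where
  "orth P \<Pi> = {t. \<forall>\<pi>\<in>\<Pi>. Apps t \<pi> \<in> P}"

text \<open>
  The element \<open>None\<close> marks the truth values of classical types. A realizer of an implication with an
  unmarked conclusion has to be equivalent to an abstraction or to the variable \<open>Var 3\<close>, which is kept
  free for realizing the type of the second argument of an integer.
\<close>

definition classical_value :: "trm set \<Rightarrow> trm list set \<Rightarrow> trm option set" where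
  "classical_value P \<Pi> = insert None (Some ` orth P \<Pi>)"

definition arrow :: "trm option set \<Rightarrow> trm option set \<Rightarrow> trm option set" where
  "arrow S T = (T \<inter> {None}) \<union> Some ` {t. (\<forall>u. Some u \<in> S \<longrightarrow> Some (App t u) \<in> T) \<and>
     (None \<in> T \<or> (\<exists>u. beta_equiv t (Lam u)) \<or> beta_equiv t (Var 3))}"

text \<open>Closure is demanded under \<beta>-expansion alone, which admits the \<beta>-equivalence
  classes used to read off an integer.\<close>

definition ordinary_values :: "trm option set set" where
  "ordinary_values = {S. None \<notin> S \<and>
     (\<forall>u t ts. Some (Apps (subst0 t u) ts) \<in> S \<longrightarrow> Some (Apps (App (Lam u) t) ts) \<in> S)}"

definition pole_values :: "trm set \<Rightarrow> kind \<Rightarrow> trm option set set" where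
  "pole_values P \<kappa> = range (classical_value P) \<union> (if \<kappa> = Ordinary then ordinary_values else {})"

lemma None_classical_value [simp]: "None \<in> classical_value P \<Pi>"
  by (simp add: classical_value_def)

lemma Some_classical_value [simp]:
  "Some t \<in> classical_value P \<Pi> \<longleftrightarrow> (\<forall>\<pi>\<in>\<Pi>. Apps t \<pi> \<in> P)"
  by (auto simp: classical_value_def orth_def)

lemma None_arrow [simp]: "None \<in> arrow S T \<longleftrightarrow> None \<in> T"
  by (auto simp: arrow_def)

lemma Some_arrow [simp]:
  "Some t \<in> arrow S T \<longleftrightarrow> (\<forall>u. Some u \<in> S \<longrightarrow> Some (App t u) \<in> T) \<and>
     (None \<in> T \<or> (\<exists>u. beta_equiv t (Lam u)) \<or> beta_equiv t (Var 3))"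
  by (auto simp: arrow_def)

lemma option_set_eqI:
  "(None \<in> S \<longleftrightarrow> None \<in> T) \<Longrightarrow> (\<And>t. Some t \<in> S \<longleftrightarrow> Some t \<in> T) \<Longrightarrow> S = T"
  by (metis not_None_eq set_eqI)

text \<open>The mark in the conclusion switches off the shape condition of \<open>arrow\<close>;
  what remains is Krivine's implication, which pushes a realizer onto the stack.\<close>

lemma arrow_classical_value:
  "arrow S (classical_value P \<Pi>) = classical_value P {u # \<pi> | u \<pi>. Some u \<in> S \<and> \<pi> \<in> \<Pi>}"
proof (rule option_set_eqI)
  show "Some t \<in> arrow S (classical_value P \<Pi>) \<longleftrightarrow>
      Some t \<in> classical_value P {u # \<pi> | u \<pi>. Some u \<in> S \<and> \<pi> \<in> \<Pi>}" for t
  proof -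
    have "(\<forall>u. Some u \<in> S \<longrightarrow> (\<forall>\<pi>\<in>\<Pi>. Apps (App t u) \<pi> \<in> P)) \<longleftrightarrow>
        (\<forall>\<pi>'\<in>{u # \<pi> | u \<pi>. Some u \<in> S \<and> \<pi> \<in> \<Pi>}. Apps t \<pi>' \<in> P)" (is "?l \<longleftrightarrow> ?r")
    proof
      show ?l if ?r
      proof (intro allI impI ballI)
        fix u \<pi> assume "Some u \<in> S" "\<pi> \<in> \<Pi>"
        then show "Apps (App t u) \<pi> \<in> P"
          using bspec[OF \<open>?r\<close>, of "u # \<pi>"] by simp
      qed
    qed auto
    then show ?thesis
      by simp
  qed
qed simp

lemma Inter_classical_values:
  assumes "F \<subseteq> range (classical_value P)"
  shows "\<Inter>F \<in> range (classical_value P)"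
proof -
  from assms obtain \<P> where F: "F = classical_value P ` \<P>"
    by (auto simp: subset_image_iff)
  have "\<Inter>F = classical_value P (\<Union>\<P>)"
    unfolding F by (rule option_set_eqI) auto
  then show ?thesis by blast
qed

section \<open>Closure of truth values over a pole, and the realizer of double negation
  elimination\<close>

locale pole =
  fixes P :: "trm set"
  assumes headC_expansion: "headC_step t t' \<Longrightarrow> t' \<in> P \<Longrightarrow> t \<in> P"
begin

lemma pole_values_beta_expansion:
  assumes "S \<in> pole_values P \<kappa>" and "Some (Apps (subst0 t u) ts) \<in> S"
  shows "Some (Apps (App (Lam u) t) ts) \<in> S"
proof -
  have "Apps (App (Lam u) t) (ts @ \<pi>) \<in> P" if "Apps (subst0 t u) (ts @ \<pi>) \<in> P" for \<pi>
    using head_beta that by (rule headC_expansion)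
  then show ?thesis
    using assms by (auto simp: pole_values_def ordinary_values_def split: if_splits)
qed

lemma arrow_pole_values:
  assumes "T \<in> pole_values P \<kappa>"
  shows "arrow S T \<in> pole_values P \<kappa>"
proof (cases "T \<in> range (classical_value P)")
  case True
  then show ?thesis
    by (auto simp: pole_values_def arrow_classical_value)
next
  case False
  then have T: "T \<in> ordinary_values" "\<kappa> = Ordinary"
    using assms by (auto simp: pole_values_def split: if_splits)
  have "arrow S T \<in> ordinary_values"
    unfolding ordinary_values_def mem_Collect_eq
  proof (intro conjI allI impI)
    show "None \<notin> arrow S T"
      using T by (simp add: ordinary_values_def)
    fix u t ts
    assume t: "Some (Apps (subst0 t u) ts) \<in> arrow S T"
    have "beta_equiv (Apps (App (Lam u) t) ts) (Apps (subst0 t u) ts)"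
      by (intro beta_equiv_Apps r_into_equivclp beta_red)
    then have "(\<exists>v. beta_equiv (Apps (App (Lam u) t) ts) (Lam v)) \<or>
        beta_equiv (Apps (App (Lam u) t) ts) (Var 3)"
      using t T by (auto simp: ordinary_values_def intro: equivclp_trans)
    moreover have "Some (App (Apps (App (Lam u) t) ts) v) \<in> T" if "Some v \<in> S" for v
      using pole_values_beta_expansion[OF assms, of t u "ts @ [v]"] t that by simp
    ultimately show "Some (Apps (App (Lam u) t) ts) \<in> arrow S T"
      by simp
  qed
  then show ?thesis
    using T by (simp add: pole_values_def)
qed

text \<open>One unmarked member makes the whole intersection unmarked, and expansion closure is
  common to all members. Otherwise the defining sets of stacks are united.\<close>

lemma Inter_pole_values:
  assumes "F \<subseteq> pole_values P \<kappa>"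
  shows "\<Inter>F \<in> pole_values P \<kappa>"
proof (cases "F \<subseteq> range (classical_value P)")
  case True
  then show ?thesis
    using Inter_classical_values by (auto simp: pole_values_def)
next
  case False
  then obtain S where S: "S \<in> F" "S \<in> ordinary_values" "\<kappa> = Ordinary"
    using assms by (auto simp: pole_values_def split: if_splits)
  have "Some (Apps (App (Lam u) t) ts) \<in> \<Inter>F" if "Some (Apps (subst0 t u) ts) \<in> \<Inter>F" for u t ts
    using that assms pole_values_beta_expansion by blast
  then have "\<Inter>F \<in> ordinary_values"
    using S by (auto simp: ordinary_values_def)
  then show ?thesis
    using S by (simp add: pole_values_def)
qed

text \<open>\<open>CC\<close> hands the stack to its argument as the continuation \<open>?k\<close>.
  One \<beta>-step of \<open>?k\<close> applied to \<open>u\<close> puts \<open>u\<close> back in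
  front of that stack, so \<open>?k\<close> realizes the negation of \<open>S\<close>.\<close>

lemma realizes_double_negation_elim:
  assumes "S \<in> range (classical_value P)"
  shows "Some CC \<in> arrow (arrow (arrow S (classical_value P {[]})) (classical_value P {[]})) S"
proof -
  obtain \<Pi> where S: "S = classical_value P \<Pi>"
    using assms by blast
  have "Apps (App CC t) \<pi> \<in> P"
    if t: "Some t \<in> arrow (arrow S (classical_value P {[]})) (classical_value P {[]})"
      and \<pi>: "\<pi> \<in> \<Pi>" for t \<pi>
  proof (rule headC_expansion[OF head_C])
    let ?k = "Lam (Apps (Var 0) (map (rename Suc) \<pi>))"
    have "App ?k u \<in> P" if "Some u \<in> S" for u
    proof (rule headC_expansion)
      show "headC_step (App ?k u) (Apps u \<pi>)"
        using head_beta[of "Apps (Var 0) (map (rename Suc) \<pi>)" u "[]"]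
        by (simp add: subst0_def subst_Apps subst_rename o_def subst_Var)
      show "Apps u \<pi> \<in> P"
        using that \<pi> by (simp add: S)
    qed
    then show "App t ?k \<in> P"
      using t by simp
  qed
  then show ?thesis
    by (simp add: S)
qed

lemma realizability_pole:
  "realizability_model arrow (classical_value P {[]}) (pole_values P) Some"
proof unfold_locales
  show "classical_value P {[]} \<in> pole_values P Classical"
    by (simp add: pole_values_def)
  show "S \<in> pole_values P Ordinary" if "S \<in> pole_values P \<kappa>" for S \<kappa>
    using that by (auto simp: pole_values_def split: if_splits)
  show "arrow S T \<in> pole_values P \<kappa>" if "T \<in> pole_values P \<kappa>" for S T \<kappa>
    using that by (rule arrow_pole_values)
  show "\<Inter>F \<in> pole_values P \<kappa>" if "F \<subseteq> pole_values P \<kappa>" for F \<kappa>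
    using that by (rule Inter_pole_values)
  show "Some CC \<in> arrow (arrow (arrow S (classical_value P {[]})) (classical_value P {[]})) S"
    if "S \<in> pole_values P Classical" for S
    using that by (intro realizes_double_negation_elim) (simp add: pole_values_def)
  show "Some (Lam t) \<in> arrow S T"
    if "T \<in> pole_values P Ordinary" "\<And>u. Some u \<in> S \<Longrightarrow> Some (subst0 u t) \<in> T" for S T t
  proof -
    have "Some (App (Lam t) u) \<in> T" if "Some u \<in> S" for u
      using pole_values_beta_expansion[OF \<open>T \<in> _\<close>, of u t "[]"]
        \<open>\<And>u. Some u \<in> S \<Longrightarrow> Some (subst0 u t) \<in> T\<close>[OF that]
      by simp
    then show ?thesis
      unfolding Some_arrow using equivclp_refl[of beta "Lam t"] by blast
  qed
  show "Some (App t u) \<in> T" if "Some t \<in> arrow S T" "Some u \<in> S" for t u S T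
    using that by simp
qed

end


section \<open>Symbolic runs\<close>

instance trm :: countable
  by countable_datatype

text \<open>
  In a symbolic run, \<open>Var 0\<close> stands for an integer of value \<open>n\<close>, \<open>Var 1\<close> for the variable \<open>f\<close> of the
  theorem, and \<open>Var 2\<close>, \<open>Var 3\<close> do not occur. A further variable \<open>x\<close> with \<open>symbol x = (a, b, k)\<close> stands
  for a term that behaves like \<open>(b)\<^sup>k a\<close>, up to backtracking; every triple has arbitrarily
  large names.
\<close>

definition symbol :: "nat \<Rightarrow> trm \<times> trm \<times> nat" where
  "symbol x = from_nat (fst (prod_decode x))"

definition run_symbol :: "trm \<Rightarrow> trm \<Rightarrow> nat \<Rightarrow> nat \<Rightarrow> bool" where
  "run_symbol a b k x \<longleftrightarrow>
     4 \<le> x \<and> symbol x = (a, b, k) \<and> free_vars a \<union> free_vars b \<subseteq> {..<x} - {2, 3}"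

lemma run_symbol_unique:
  "run_symbol a b k x \<Longrightarrow> run_symbol a' b' k' x \<Longrightarrow> a' = a \<and> b' = b \<and> k' = k"
  by (simp add: run_symbol_def)

lemma ex_run_symbol:
  assumes "free_vars a \<inter> {2, 3} = {}" and "free_vars b \<inter> {2, 3} = {}" and "finite V"
  shows "\<exists>x. run_symbol a b k x \<and> V \<subseteq> {..<x}"
proof -
  obtain m where m: "free_vars a \<union> free_vars b \<union> V \<subseteq> {..<m}"
    using finite_nat_set_iff_bounded[of "free_vars a \<union> free_vars b \<union> V"] assms(3) finite_free_vars
    by auto
  define x where "x = prod_encode (to_nat (a, b, k), m + 4)"
  have "m + 4 \<le> x"
    unfolding x_def by (rule le_prod_encode_2)
  then have "{..<m} \<subseteq> {..<x}" "4 \<le> x"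
    by auto
  then have "run_symbol a b k x \<and> V \<subseteq> {..<x}"
    using m assms(1,2) by (auto simp: run_symbol_def symbol_def x_def)
  then show ?thesis ..
qed

text \<open>One demand for \<open>(b)^k a\<close> on a stack. The new symbol exceeds all names in
  \<open>a\<close>, \<open>b\<close> and the stack, so its value can be chosen later without
  affecting them.\<close>

definition unfolds :: "nat \<Rightarrow> trm \<Rightarrow> trm \<Rightarrow> trm list \<Rightarrow> trm \<Rightarrow> bool" where
  "unfolds k a b \<pi> q \<longleftrightarrow> (case k of
     0 \<Rightarrow> q = Apps a \<pi>
   | Suc j \<Rightarrow> \<exists>x. run_symbol a b j x \<and> (\<Union>u\<in>set \<pi>. free_vars u) \<subseteq> {..<x} \<and>
       q = Apps (App b (Var x)) \<pi>)"

inductive run :: "nat \<Rightarrow> trm \<Rightarrow> trm \<Rightarrow> bool" for n :: nat and \<tau> :: trm where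
  run_final: "run n \<tau> (App (Var 1) \<tau>)"
| run_step: "headC_step p q \<Longrightarrow> run n \<tau> q \<Longrightarrow> run n \<tau> p"
| run_integer: "unfolds n a b \<pi> q \<Longrightarrow> run n \<tau> q \<Longrightarrow> run n \<tau> (Apps (App (App (Var 0) a) b) \<pi>)"
| run_unfold: "run_symbol a b k x \<Longrightarrow> unfolds k a b \<pi> q \<Longrightarrow> run n \<tau> q \<Longrightarrow>
    run n \<tau> (Apps (Var x) \<pi>)"

text \<open>Terms with a reserved variable belong to the pole vacuously: realizers can be tested on
  arbitrary terms, yet only a term free of these variables has to be accepted by
  \<open>Var 1\<close>.\<close>

definition run_pole :: "nat \<Rightarrow> trm set" where
  "run_pole n = {p. free_vars p \<inter> {2, 3} = {} \<longrightarrow> (\<exists>\<tau>. beta_equiv \<tau> (church n) \<and> run n \<tau> p)}"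

lemma run_poleI:
  assumes "q \<in> run_pole n" and "free_vars p \<inter> {2, 3} = {} \<Longrightarrow> free_vars q \<inter> {2, 3} = {}"
    and "\<And>\<tau>. free_vars p \<inter> {2, 3} = {} \<Longrightarrow> run n \<tau> q \<Longrightarrow> run n \<tau> p"
  shows "p \<in> run_pole n"
  using assms unfolding run_pole_def by blast

lemma pole_run_pole: "pole (run_pole n)"
proof
  fix t t' assume step: "headC_step t t'" and t': "t' \<in> run_pole n"
  show "t \<in> run_pole n"
  proof (rule run_poleI[OF t'])
    show "run n \<tau> t' \<Longrightarrow> run n \<tau> t" for \<tau>
      using step by (rule run_step)
  qed (use free_vars_headC_step[OF step] in blast)
qed

section \<open>Numerals modulo the equations\<close>

abbreviation num :: "('f, 'p) language \<Rightarrow> nat \<Rightarrow> 'f fotm" where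
  "num L k \<equiv> (suc_tm L ^^ k) (zero_tm L)"

lemma tsubst_num: "tsubst \<eta> (num L k) = num L k"
  by (induction k) (simp_all add: zero_tm_def suc_tm_def)

lemma wf_num: "is_language L \<Longrightarrow> wf_tm L (num L k)"
  by (induction k) (simp_all add: zero_tm_def suc_tm_def is_language_def)

lemma wf_suc_tm: "is_language L \<Longrightarrow> wf_tm L d \<Longrightarrow> wf_tm L (suc_tm L d)"
  by (simp add: suc_tm_def is_language_def)

lemma approx_suc_num:
  assumes "is_language L" "wf_equations L E" "adequate_for_integers L E"
    and "wf_tm L d" and "approx L E (suc_tm L d) (num L k)"
  obtains j where "k = Suc j" and "approx L E d (num L j)"
proof (cases k)
  case 0
  have "eq_conseq L E (suc_tm L d) (zero_tm L)"
    using approx_eq_conseq[OF assms(2,5)] wf_suc_tm[OF assms(1,4)] 0 by simp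
  then show ?thesis
    using assms(3) by (simp add: adequate_for_integers_def)
next
  case (Suc j)
  have "eq_conseq L E (suc_tm L d) (suc_tm L (num L j))"
    using approx_eq_conseq[OF assms(2,5)] wf_suc_tm[OF assms(1,4)] Suc by simp
  then have "eq_conseq L E d (num L j)"
    using assms(3) by (auto simp: adequate_for_integers_def)
  then have "approx L E d (num L j)"
    using eq_conseq_approx[of L E d "num L j" TVar] by (simp add: tsubst_TVar)
  then show ?thesis
    using Suc that by blast
qed

lemma approx_num_unique:
  assumes "is_language L" "wf_equations L E" "adequate_for_integers L E"
  shows "approx L E (num L n) (num L k) \<Longrightarrow> n = k"
proof (induction n arbitrary: k)
  case 0
  show ?case
  proof (cases k)
    case (Suc j)
    then have "approx L E (suc_tm L (num L j)) (num L 0)"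
      using 0 by (auto intro: approx_sym)
    then show ?thesis
      using approx_suc_num[OF assms wf_num[OF assms(1)]] by blast
  qed simp
next
  case (Suc n)
  then have "approx L E (suc_tm L (num L n)) (num L k)"
    by simp
  then obtain j where "k = Suc j" "approx L E (num L n) (num L j)"
    using approx_suc_num[OF assms wf_num[OF assms(1)]] by blast
  then show ?case
    using Suc.IH by simp
qed

text \<open>\<open>R k\<close> is the truth value of a predicate at the numeral \<open>k\<close>.
  Unfolding moves pole membership to \<open>a\<close>, or to \<open>b\<close> applied to a lower
  symbol, which is a realizer by induction.\<close>

lemma symbol_realizes:
  assumes "run_symbol a b k x"
    and "\<And>k. \<exists>\<Pi>. R k = classical_value (run_pole n) \<Pi>"
    and "Some a \<in> R 0" and "\<And>k t. Some t \<in> R k \<Longrightarrow> Some (App b t) \<in> R (Suc k)"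
  shows "Some (Var x) \<in> R k"
  using assms(1)
proof (induction k arbitrary: x)
  case 0
  obtain \<Pi> where \<Pi>: "R 0 = classical_value (run_pole n) \<Pi>"
    using assms(2) by blast
  have "Apps (Var x) \<pi> \<in> run_pole n" if "\<pi> \<in> \<Pi>" for \<pi>
  proof (rule run_poleI)
    show "Apps a \<pi> \<in> run_pole n"
      using assms(3) that by (simp add: \<Pi>)
    show "run n \<tau> (Apps a \<pi>) \<Longrightarrow> run n \<tau> (Apps (Var x) \<pi>)" for \<tau>
      by (rule run_unfold[OF 0]) (simp_all add: unfolds_def)
  qed (use 0 in \<open>auto simp: run_symbol_def free_vars_Apps\<close>)
  then show ?case
    by (simp add: \<Pi>)
next
  case (Suc k)
  obtain \<Pi> where \<Pi>: "R (Suc k) = classical_value (run_pole n) \<Pi>"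
    using assms(2) by blast
  have "Apps (Var x) \<pi> \<in> run_pole n" if "\<pi> \<in> \<Pi>" for \<pi>
  proof -
    have fresh: "free_vars a \<inter> {2, 3} = {}" "free_vars b \<inter> {2, 3} = {}"
      using Suc.prems by (auto simp: run_symbol_def)
    obtain y where y: "run_symbol a b k y" "(\<Union>u\<in>set \<pi>. free_vars u) \<subseteq> {..<y}"
      using ex_run_symbol[OF fresh, of "\<Union>u\<in>set \<pi>. free_vars u"] finite_free_vars by blast
    show ?thesis
    proof (rule run_poleI)
      show "Apps (App b (Var y)) \<pi> \<in> run_pole n"
        using assms(4)[OF Suc.IH[OF y(1)]] that by (simp add: \<Pi>)
      show "run n \<tau> (Apps (App b (Var y)) \<pi>) \<Longrightarrow> run n \<tau> (Apps (Var x) \<pi>)" for \<tau>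
        by (rule run_unfold[OF Suc.prems]) (use y in \<open>auto simp: unfolds_def\<close>)
    qed (use fresh y in \<open>auto simp: run_symbol_def free_vars_Apps\<close>)
  qed
  then show ?case
    by (simp add: \<Pi>)
qed

lemma integer_realizes:
  assumes R: "\<And>k. \<exists>\<Pi>. R k = classical_value (run_pole n) \<Pi>"
    and a: "Some a \<in> R 0" and b: "\<And>k t. Some t \<in> R k \<Longrightarrow> Some (App b t) \<in> R (Suc k)"
  shows "Some (App (App (Var 0) a) b) \<in> R n"
proof -
  obtain \<Pi> where \<Pi>: "R n = classical_value (run_pole n) \<Pi>"
    using R by blast
  have "Apps (App (App (Var 0) a) b) \<pi> \<in> run_pole n" if "\<pi> \<in> \<Pi>" for \<pi>
  \<comment> \<open>New symbols exist only over \<open>a\<close> and \<open>b\<close> without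
    reserved variables; a term containing one lies in the pole vacuously.\<close>
  proof (cases "free_vars (Apps (App (App (Var 0) a) b) \<pi>) \<inter> {2, 3} = {}")
    case True
    then have fresh: "free_vars a \<inter> {2, 3} = {}" "free_vars b \<inter> {2, 3} = {}"
      by (auto simp: free_vars_Apps)
    show ?thesis
    proof (cases n)
      case 0
      show ?thesis
      proof (rule run_poleI)
        show "Apps a \<pi> \<in> run_pole n"
          using a that \<Pi> 0 by simp
        show "run n \<tau> (Apps a \<pi>) \<Longrightarrow> run n \<tau> (Apps (App (App (Var 0) a) b) \<pi>)" for \<tau>
          by (rule run_integer) (simp_all add: unfolds_def 0)
      qed (auto simp: free_vars_Apps)
    next
      case (Suc k)
      obtain y where y: "run_symbol a b k y" "(\<Union>u\<in>set \<pi>. free_vars u) \<subseteq> {..<y}"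
        using ex_run_symbol[OF fresh, of "\<Union>u\<in>set \<pi>. free_vars u"] finite_free_vars by blast
      have "Some (Var y) \<in> R k"
        using y(1) R a b by (intro symbol_realizes) auto
      then have "Some (App b (Var y)) \<in> R n"
        using b Suc by simp
      show ?thesis
      proof (rule run_poleI)
        show "Apps (App b (Var y)) \<pi> \<in> run_pole n"
          using \<open>Some (App b (Var y)) \<in> R n\<close> that by (simp add: \<Pi>)
        show "run n \<tau> (Apps (App b (Var y)) \<pi>) \<Longrightarrow> run n \<tau> (Apps (App (App (Var 0) a) b) \<pi>)" for \<tau>
          by (rule run_integer) (use y Suc in \<open>auto simp: unfolds_def\<close>)
      qed (use fresh y in \<open>auto simp: run_symbol_def free_vars_Apps\<close>)
    qed
  qed (auto simp: run_pole_def)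
  then show ?thesis
    by (simp add: \<Pi>)
qed

text \<open>By adequacy over \<open>run_pole n\<close> it suffices that \<open>Var 0\<close>
  realizes \<open>N Classical\<close> and that \<open>Var 1\<close> realizes the negation of
  \<open>N Ordinary\<close>.\<close>

lemma ex_run:
  assumes L: "is_language L" "wf_equations L E" "adequate_for_integers L E"
    and T: "closed_trm T" "M2 L E [] T
      (All1 (Imp (Nat_fm L Classical (TVar 0)) (Neg (Neg (Nat_fm L Ordinary (TVar 0))))))"
  shows "\<exists>\<tau>. beta_equiv \<tau> (church n) \<and> run n \<tau> (App (App T (Var 0)) (Var 1))"
proof -
  let ?bot = "classical_value (run_pole n) {[]}"
  interpret pole "run_pole n"
    by (rule pole_run_pole)
  interpret realizability_model L E arrow ?bot "pole_values (run_pole n)" Some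
    by (rule realizability_pole)
  \<comment> \<open>The type of \<open>T\<close> is closed, so \<open>S\<close> and
    \<open>\<eta>\<close> are arbitrary valid choices.\<close>
  define S where "S = (\<lambda>(\<kappa> :: kind) (k :: nat) (i :: nat) (as :: 'a fotm list). ?bot)"
  define \<eta> where "\<eta> = (\<lambda>_ :: nat. zero_tm L)"
  define N where "N = (\<lambda>\<kappa>. interp (Nat_fm L \<kappa> (TVar 0)) (case_nat (num L n) \<eta>) S)"
  have wf: "wf_tm L (\<eta> i)" for i
    using wf_num[OF L(1), of 0] by (simp add: \<eta>_def)
  have S: "valid S"
    by (auto simp: S_def valid_def Pred_def pole_values_def)
  have N: "Some t \<in> N \<kappa> \<longleftrightarrow> (\<forall>R\<in>Pred \<kappa>. Some t \<in> arrow (R [num L 0])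
      (arrow (\<Inter>d\<in>{d. wf_tm L d}. arrow (R [d]) (R [suc_tm L d])) (R [num L n])))" for t \<kappa>
    by (simp add: N_def Nat_fm_def push_apply zero_tm_def suc_tm_def)
  have "Some T \<in> arrow (N Classical) (arrow (arrow (N Ordinary) ?bot) ?bot)"
    using M2_sound_closed[OF T(2,1) wf S] wf_num[OF L(1), of n] by (auto simp: N_def)
  moreover have "Some (Var 0) \<in> N Classical"
  proof (unfold N, intro ballI)
    fix R :: "'a fotm list \<Rightarrow> trm option set"
    assume R: "R \<in> Pred Classical"
    have classical: "\<exists>\<Pi>. R as = classical_value (run_pole n) \<Pi>" for as
      using Pred_Val[OF R, of as] by (auto simp: pole_values_def)
    have None: "None \<in> R as" for as
      using classical[of as] by (metis None_classical_value)
    have "Some (App (App (Var 0) a) b) \<in> R [num L n]"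
      if a: "Some a \<in> R [num L 0]"
        and b: "\<And>d u. wf_tm L d \<Longrightarrow> Some u \<in> R [d] \<Longrightarrow> Some (App b u) \<in> R [suc_tm L d]" for a b
    proof (rule integer_realizes[of "\<lambda>k. R [num L k]"])
      show "Some (App b u) \<in> R [num L (Suc k)]" if "Some u \<in> R [num L k]" for k u
        using b[OF wf_num[OF L(1)] that] by simp
      show "\<exists>\<Pi>. R [num L k] = classical_value (run_pole n) \<Pi>" for k
        by (rule classical)
    qed (rule a)
    then show "Some (Var 0) \<in> arrow (R [num L 0])
        (arrow (\<Inter>d\<in>{d. wf_tm L d}. arrow (R [d]) (R [suc_tm L d])) (R [num L n]))"
      using None by simp
  qed
  moreover have "Some (Var 1) \<in> arrow (N Ordinary) ?bot"
  proof -
    have "beta_equiv \<tau> (church n)" if \<tau>: "Some \<tau> \<in> N Ordinary" and fresh: "free_vars \<tau> \<inter> {2, 3} = {}"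
      for \<tau>
    proof -
      \<comment> \<open>At \<open>s^k(0)\<close> this predicate holds the terms equivalent to
        \<open>(f)^k x\<close>, with \<open>Var 3\<close> as \<open>f\<close> and
        \<open>Var 2\<close> as \<open>x\<close>. It carries no mark, so the shape condition of
        \<open>arrow\<close> is in force.\<close>
      define R where "R as = Some ` {t. \<exists>a k. as = [a] \<and> approx L E a (num L k) \<and>
          beta_equiv t ((App (Var 3) ^^ k) (Var 2))}" for as
      have R_iff: "Some t \<in> R [a] \<longleftrightarrow>
          (\<exists>k. approx L E a (num L k) \<and> beta_equiv t ((App (Var 3) ^^ k) (Var 2)))" for t a
        by (auto simp: R_def)
      have None: "None \<notin> R as" for as
        by (auto simp: R_def)
      have "R \<in> Pred Ordinary"
      proof (rule PredI)
        fix as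
        have "beta_equiv (Apps (App (Lam u) t) ts) (Apps (subst0 t u) ts)" for u t ts
          by (intro beta_equiv_Apps r_into_equivclp beta_red)
        then have "Some (Apps (App (Lam u) t) ts) \<in> R as" if "Some (Apps (subst0 t u) ts) \<in> R as"
          for u t ts
          using that unfolding R_def by (blast intro: equivclp_trans)
        then show "R as \<in> pole_values (run_pole n) Ordinary"
          using None by (simp add: pole_values_def ordinary_values_def)
      next
        fix as bs assume "list_all2 (approx L E) as bs"
        then show "R as \<subseteq> R bs"
          unfolding R_def by (auto simp: list_all2_Cons1) (blast intro: approx_sym approx_trans)
      qed
      then have main: "Some \<tau> \<in> arrow (R [num L 0])
          (arrow (\<Inter>d\<in>{d. wf_tm L d}. arrow (R [d]) (R [suc_tm L d])) (R [num L n]))"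
        using \<tau> N by blast
      have x: "Some (Var 2) \<in> R [num L 0]"
        unfolding R_iff by (intro exI[of _ 0]) (simp add: approx_refl)
      have "Some (App (Var 3) u) \<in> R [suc_tm L d]" if u: "Some u \<in> R [d]" for u d
      proof -
        obtain k where "approx L E d (num L k)" "beta_equiv u ((App (Var 3) ^^ k) (Var 2))"
          using u R_iff by blast
        then show ?thesis
          unfolding R_iff
          by (intro exI[of _ "Suc k"]) (simp add: approx_suc_tm beta_equiv_App)
      qed
      \<comment> \<open>\<open>Var 3\<close> meets the shape condition through the disjunct made for
        it.\<close>
      then have f: "Some (Var 3) \<in> (\<Inter>d\<in>{d. wf_tm L d}. arrow (R [d]) (R [suc_tm L d]))"
        by simp
      have "Some (App (App \<tau> (Var 2)) (Var 3)) \<in> R [num L n]"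
        using main x f by simp
      then have "beta_equiv (App (App \<tau> (Var 2)) (Var 3)) ((App (Var 3) ^^ n) (Var 2))"
        using approx_num_unique[OF L, of n] unfolding R_iff by blast
      moreover have "(\<exists>u. beta_equiv \<tau> (Lam u)) \<or> beta_equiv \<tau> (Var 3)"
        using main None by simp
      moreover have "(\<exists>u. beta_equiv (App \<tau> (Var 2)) (Lam u)) \<or> beta_equiv (App \<tau> (Var 2)) (Var 3)"
        using main None x by simp
      ultimately show ?thesis
        using fresh by (intro beta_equiv_church)
    qed
    then have "App (Var 1) \<tau> \<in> run_pole n" if "Some \<tau> \<in> N Ordinary" for \<tau>
      using that run_final[of n \<tau>] by (auto simp: run_pole_def)
    then show ?thesis
      by simp
  qed
  ultimately have "App (App T (Var 0)) (Var 1) \<in> run_pole n"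
    by simp
  then show ?thesis
    using T(1) by (simp add: run_pole_def closed_trm_def)
qed


section \<open>Instances of a symbolic run\<close>

text \<open>The argument of \<open>b\<close> ranges over the whole orthogonal of the level below, as
  a backtracking integer passes terms that merely behave like \<open>(b)^k a\<close>.\<close>

fun stacks :: "trm set \<Rightarrow> trm \<Rightarrow> trm \<Rightarrow> nat \<Rightarrow> trm list set" where
  "stacks P a b 0 = {\<pi>. Apps a \<pi> \<in> P}"
| "stacks P a b (Suc k) = {\<pi>. \<forall>t\<in>orth P (stacks P a b k). Apps (App b t) \<pi> \<in> P}"

lemma classical_integer_stacks:
  assumes L: "is_language L" "wf_equations L E" "adequate_for_integers L E"
    and "pole P" and \<theta>: "classical_integer L E n \<theta>" and \<pi>: "\<pi> \<in> stacks P a b n"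
  shows "Apps (App (App \<theta> a) b) \<pi> \<in> P"
proof -
  let ?bot = "classical_value P {[]}"
  interpret pole P by fact
  interpret realizability_model L E arrow ?bot "pole_values P" Some
    by (rule realizability_pole)
  define S where "S = (\<lambda>(\<kappa> :: kind) (k :: nat) (i :: nat) (as :: 'a fotm list). ?bot)"
  define \<eta> where "\<eta> = (\<lambda>_ :: nat. zero_tm L)"
  \<comment> \<open>At \<open>s^k(0)\<close> this is the orthogonal of level \<open>k\<close>, since
    by adequacy only one \<open>k\<close> fits. An individual equal to no numeral gets no stacks,
    hence the full truth value.\<close>
  define R where "R as = classical_value P {\<pi>. \<exists>d k. as = [d] \<and> approx L E d (num L k) \<and>
      \<pi> \<in> stacks P a b k}" for as
  have R_iff: "Some t \<in> R [d] \<longleftrightarrow>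
      (\<forall>k \<pi>. approx L E d (num L k) \<longrightarrow> \<pi> \<in> stacks P a b k \<longrightarrow> Apps t \<pi> \<in> P)" for t d
    by (auto simp: R_def)
  have None: "None \<in> R as" for as
    by (simp add: R_def)
  have wf: "wf_tm L (\<eta> i)" for i
    using wf_num[OF L(1), of 0] by (simp add: \<eta>_def)
  have S: "valid S"
    by (auto simp: S_def valid_def Pred_def pole_values_def)
  have R: "R \<in> Pred Classical"
  proof (rule PredI)
    fix as bs assume "list_all2 (approx L E) as bs"
    then have "{\<pi>. \<exists>d k. bs = [d] \<and> approx L E d (num L k) \<and> \<pi> \<in> stacks P a b k} \<subseteq>
        {\<pi>. \<exists>d k. as = [d] \<and> approx L E d (num L k) \<and> \<pi> \<in> stacks P a b k}"
      by (auto simp: list_all2_Cons2) (blast intro: approx_trans)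
    then show "R as \<subseteq> R bs"
      unfolding R_def classical_value_def orth_def by blast
  qed (simp add: R_def pole_values_def)
  have "Some \<theta> \<in> interp (Nat_fm L Classical (num L n)) \<eta> S"
    using \<theta> M2_sound_closed[OF _ _ wf S] by (simp add: classical_integer_def)
  then have "Some \<theta> \<in> arrow (R [num L 0])
      (arrow (\<Inter>d\<in>{d. wf_tm L d}. arrow (R [d]) (R [suc_tm L d])) (R [num L n]))"
    using R by (simp add: Nat_fm_def push_apply tsubst_num) (simp add: zero_tm_def suc_tm_def)
  moreover have "Some a \<in> R [num L 0]"
    unfolding R_iff
  proof (intro allI impI)
    fix k \<pi>
    assume "approx L E (num L 0) (num L k)" and \<pi>: "\<pi> \<in> stacks P a b k"
    then have "k = 0"
      using approx_num_unique[OF L] by blast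
    then show "Apps a \<pi> \<in> P"
      using \<pi> by simp
  qed
  moreover have "Some b \<in> arrow (R [d]) (R [suc_tm L d])" if "wf_tm L d" for d
  proof -
    have "Some (App b u) \<in> R [suc_tm L d]" if u: "Some u \<in> R [d]" for u
      unfolding R_iff
    proof (intro allI impI)
      fix k \<pi>
      assume "approx L E (suc_tm L d) (num L k)" and \<pi>: "\<pi> \<in> stacks P a b k"
      then obtain j where j: "k = Suc j" "approx L E d (num L j)"
        using approx_suc_num[OF L \<open>wf_tm L d\<close>] by blast
      then have "u \<in> orth P (stacks P a b j)"
        using u by (auto simp: R_iff orth_def)
      then show "Apps (App b u) \<pi> \<in> P"
        using \<pi> j by simp
    qed
    then show ?thesis
      using None by simp
  qed
  ultimately have "Some (App (App \<theta> a) b) \<in> R [num L n]"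
    by simp
  then show ?thesis
    using \<pi> unfolding R_iff by (auto intro: approx_refl)
qed

text \<open>
  The set \<open>V\<close> collects the symbols on which an instance depends hereditarily. It has to be cut down
  to the names below a new symbol, since \<open>\<sigma>\<close> may already have assigned a value to this name.
\<close>

definition good_instance :: "trm set \<Rightarrow> nat set \<Rightarrow> (nat \<Rightarrow> trm) \<Rightarrow> bool" where
  "good_instance P V \<sigma> \<longleftrightarrow> (\<forall>x\<in>V. \<forall>a b k. run_symbol a b k x \<longrightarrow>
     free_vars a \<union> free_vars b \<subseteq> V \<and> \<sigma> x \<in> orth P (stacks P (subst \<sigma> a) (subst \<sigma> b) k))"

text \<open>Every retained symbol lies below \<open>x\<close>, as do the names in its components, so
  overwriting \<open>\<sigma>\<close> at \<open>x\<close> does not disturb its condition.\<close>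

lemma good_instance_update:
  assumes "good_instance P V \<sigma>" and x: "run_symbol a b k x"
    and "free_vars a \<union> free_vars b \<subseteq> V"
    and t: "t \<in> orth P (stacks P (subst \<sigma> a) (subst \<sigma> b) k)"
  shows "good_instance P (insert x (V \<inter> {..<x})) (\<sigma>(x := t))"
proof -
  have subst_upd: "subst (\<sigma>(x := t)) u = subst \<sigma> u" if "free_vars u \<subseteq> {..<x}" for u
    using that by (intro subst_cong) auto
  have ab: "free_vars a \<union> free_vars b \<subseteq> {..<x}"
    using x by (auto simp: run_symbol_def)
  show ?thesis
    unfolding good_instance_def
  proof (intro ballI allI impI)
    fix y a' b' k'
    assume y: "y \<in> insert x (V \<inter> {..<x})" and y': "run_symbol a' b' k' y"
    show "free_vars a' \<union> free_vars b' \<subseteq> insert x (V \<inter> {..<x}) \<and> (\<sigma>(x := t)) y \<in>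
        orth P (stacks P (subst (\<sigma>(x := t)) a') (subst (\<sigma>(x := t)) b') k')"
    proof (cases "y = x")
      case True
      then have "a' = a" "b' = b" "k' = k"
        using run_symbol_unique x y' by blast+
      then show ?thesis
        using True t ab assms(3) by (auto simp: subst_upd)
    next
      case False
      then have "y < x" "y \<in> V"
        using y by auto
      moreover have "free_vars a' \<union> free_vars b' \<subseteq> {..<y}"
        using y' by (auto simp: run_symbol_def)
      moreover have "free_vars a' \<union> free_vars b' \<subseteq> V"
        "\<sigma> y \<in> orth P (stacks P (subst \<sigma> a') (subst \<sigma> b') k')"
        using assms(1) \<open>y \<in> V\<close> y' by (auto simp: good_instance_def)
      moreover have "free_vars a' \<subseteq> {..<x}" "free_vars b' \<subseteq> {..<x}"
        using calculation by auto
      ultimately show ?thesis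
        using False by (auto simp: subst_upd)
    qed
  qed
qed

text \<open>Induction along the run with the instance generalized: a new symbol must admit every
  value in its orthogonal, as the integer may restart the computation with any of them.\<close>

lemma run_instance:
  assumes P: "pole P"
    and \<theta>: "\<And>a b \<pi>. \<pi> \<in> stacks P a b n \<Longrightarrow> Apps (App (App \<theta> a) b) \<pi> \<in> P"
    and final: "\<And>\<sigma>. \<sigma> 1 = g \<Longrightarrow> App g (subst \<sigma> \<tau>) \<in> P"
    and "run n \<tau> p" and "\<sigma> 0 = \<theta>" and "\<sigma> 1 = g" and "free_vars p \<subseteq> V" and "good_instance P V \<sigma>"
  shows "subst \<sigma> p \<in> P"
proof -
  interpret pole P by (rule P)
  \<comment> \<open>Shared by the two unfolding rules: the induction hypothesis for the continuation
    \<open>q\<close> says that the instantiated stack belongs to level \<open>k\<close>.\<close>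
  have stacks: "map (subst \<sigma>) \<pi> \<in> stacks P (subst \<sigma> a) (subst \<sigma> b) k"
    if q: "unfolds k a b \<pi> q"
      and IH: "\<And>V \<sigma>. \<sigma> 0 = \<theta> \<Longrightarrow> \<sigma> 1 = g \<Longrightarrow> free_vars q \<subseteq> V \<Longrightarrow> good_instance P V \<sigma> \<Longrightarrow>
        subst \<sigma> q \<in> P"
      and \<sigma>: "\<sigma> 0 = \<theta>" "\<sigma> 1 = g" and V: "good_instance P V \<sigma>"
      and fv: "free_vars a \<subseteq> V" "free_vars b \<subseteq> V" "(\<Union>u\<in>set \<pi>. free_vars u) \<subseteq> V"
    for k a b \<pi> q \<sigma> V
  proof (cases k)
    case 0
    then have "q = Apps a \<pi>"
      using q by (simp add: unfolds_def)
    then show ?thesis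
      using IH[OF \<sigma> _ V] fv 0 by (simp add: free_vars_Apps subst_Apps)
  next
    case (Suc j)
    then obtain x where x: "run_symbol a b j x" and \<pi>: "(\<Union>u\<in>set \<pi>. free_vars u) \<subseteq> {..<x}"
      and q: "q = Apps (App b (Var x)) \<pi>"
      using q by (auto simp: unfolds_def)
    have b: "free_vars b \<subseteq> {..<x}" "x \<ge> 4"
      using x by (auto simp: run_symbol_def)
    have upd: "subst (\<sigma>(x := t)) u = subst \<sigma> u" if "free_vars u \<subseteq> {..<x}" for u t
      using that by (intro subst_cong) auto
    have "Apps (App (subst \<sigma> b) t) (map (subst \<sigma>) \<pi>) \<in> P"
      if t: "t \<in> orth P (stacks P (subst \<sigma> a) (subst \<sigma> b) j)" for t
    proof -
      \<comment> \<open>The new symbol takes the value \<open>t\<close>; by freshness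
        \<open>b\<close> and the stack keep their instances.\<close>
      have "subst (\<sigma>(x := t)) q \<in> P"
      proof (rule IH)
        show "good_instance P (insert x (V \<inter> {..<x})) (\<sigma>(x := t))"
          using V x fv t by (intro good_instance_update) auto
        show "free_vars q \<subseteq> insert x (V \<inter> {..<x})"
          using q b \<pi> fv by (auto simp: free_vars_Apps)
      qed (use \<sigma> b in auto)
      moreover have "map (subst (\<sigma>(x := t))) \<pi> = map (subst \<sigma>) \<pi>"
        using \<pi> by (intro map_cong refl upd) auto
      ultimately show ?thesis
        using b by (simp add: q subst_Apps upd)
    qed
    then show ?thesis
      using Suc by simp
  qed
  show ?thesis
    using assms(4-)
  proof (induction arbitrary: \<sigma> V rule: run.induct)
    case run_final
    then show ?case
      using final by simp
  next
    case (run_step p q)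
    have "subst \<sigma> q \<in> P"
      using run_step.prems free_vars_headC_step[OF run_step.hyps(1)]
      by (intro run_step.IH) auto
    then show ?case
      using headC_step_subst[OF run_step.hyps(1)] headC_expansion by blast
  next
    case (run_integer a b \<pi> q)
    have "map (subst \<sigma>) \<pi> \<in> stacks P (subst \<sigma> a) (subst \<sigma> b) n"
      using run_integer.prems
      by (intro stacks[OF run_integer.hyps(1) run_integer.IH]) (auto simp: free_vars_Apps)
    then show ?case
      using \<theta> run_integer.prems by (simp add: subst_Apps)
  next
    case (run_unfold a b k x \<pi> q)
    have x: "x \<in> V"
      using run_unfold.prems by (auto simp: free_vars_Apps)
    then have "free_vars a \<union> free_vars b \<subseteq> V"
      and \<sigma>x: "\<sigma> x \<in> orth P (stacks P (subst \<sigma> a) (subst \<sigma> b) k)"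
      using run_unfold.prems(4) run_unfold.hyps(1) by (auto simp: good_instance_def)
    then have "map (subst \<sigma>) \<pi> \<in> stacks P (subst \<sigma> a) (subst \<sigma> b) k"
      using run_unfold.prems
      by (intro stacks[OF run_unfold.hyps(2) run_unfold.IH]) (auto simp: free_vars_Apps)
    then show ?case
      using \<sigma>x by (simp add: orth_def subst_Apps)
  qed
qed

theorem theorem6p3:
  fixes L :: "('f, 'p) language"
    and E :: "('f fotm \<times> 'f fotm) set"
    and T :: trm
  assumes "is_language L"
    and "wf_equations L E"
    and "adequate_for_integers L E"
    and "closed_trm T"
    and "M2 L E [] T
           (All1 (Imp (Nat_fm L Classical (TVar 0)) (Neg (Neg (Nat_fm L Ordinary (TVar 0))))))"
  shows "\<forall>n. \<exists>\<tau>. beta_equiv \<tau> (church n) \<and>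
           (\<forall>\<theta>. classical_integer L E n \<theta> \<longrightarrow>
             (\<forall>f. \<exists>\<sigma>. headC_red (App (App T \<theta>) (Var f)) (App (Var f) (subst \<sigma> \<tau>))))"
proof
  fix n
  obtain \<tau> where \<tau>: "beta_equiv \<tau> (church n)" and run: "run n \<tau> (App (App T (Var 0)) (Var 1))"
    using ex_run[OF assms] by blast
  have "\<exists>\<sigma>. headC_red (App (App T \<theta>) (Var f)) (App (Var f) (subst \<sigma> \<tau>))"
    if \<theta>: "classical_integer L E n \<theta>" for \<theta> f
  proof -
    \<comment> \<open>The substitution stays existential, as it depends on the values the symbols
      have received when the run ends.\<close>
    define P where "P = {p. \<exists>\<sigma>. headC_red p (App (Var f) (subst \<sigma> \<tau>))}"
    define \<sigma> where "\<sigma> = (\<lambda>i :: nat. if i = 0 then \<theta> else Var f)"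
    have P: "pole P"
      by unfold_locales (auto simp: P_def intro: converse_rtranclp_into_rtranclp)
    have "subst \<sigma> (App (App T (Var 0)) (Var 1)) \<in> P"
    proof (rule run_instance[OF P _ _ run])
      show "Apps (App (App \<theta> a) b) \<pi> \<in> P" if "\<pi> \<in> stacks P a b n" for a b \<pi>
        using assms(1-3) P \<theta> that by (rule classical_integer_stacks)
      show "App (Var f) (subst \<sigma> \<tau>) \<in> P" for \<sigma>
        by (auto simp: P_def)
      show "free_vars (App (App T (Var 0)) (Var 1)) \<subseteq> {0, 1}"
        using assms(4) by (simp add: closed_trm_def)
      \<comment> \<open>Symbols have names from 4 on, so the condition is vacuous here.\<close>
      show "good_instance P {0, 1} \<sigma>"
        by (simp add: good_instance_def run_symbol_def)
    qed (simp_all add: \<sigma>_def)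
    then show ?thesis
      using assms(4) by (simp add: subst_closed \<sigma>_def P_def)
  qed
  then show "\<exists>\<tau>. beta_equiv \<tau> (church n) \<and> (\<forall>\<theta>. classical_integer L E n \<theta> \<longrightarrow>
      (\<forall>f. \<exists>\<sigma>. headC_red (App (App T \<theta>) (Var f)) (App (Var f) (subst \<sigma> \<tau>))))"
    using \<tau> by blast
qed

end
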